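(* Let $T$ be a string of length $n$ and let $\tau$ be a parameter with $1 \leq \tau \leq n$. Then the tandem repeats problem on $T$ can be solved (i) in $O(n/\sqrt{\tau})$ space and $O(n^2/\sqrt{\tau} + n\tau\cdot\log n + \mathrm{occ})$ time, or (ii) in $O(n/\tau)$ space and $O(n\tau\cdot\log^2 n + \mathrm{occ})$ time with high probability, where $\mathrm{occ}$ is the number of tandem repeats in $T$.
   Context: The tandem repeats problem for a string $T$ is to report all squares in $T$, i.e. all occurrences of substrings of $T$ that consist of two consecutive copies of the same nonempty string. $\mathrm{occ}$ denotes the number of such tandem repeats (reported occurrences). The input string is in read-only memory and is not counted in the space; space is measured in machine words. "With high probability" means with probability at least $1-1/n^c$ for any constant $c$. *)

theory Defs
  imports Complex_Main "HOL-Probability.Probability_Mass_Function"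
begin

section \<open>Tandem repeats\<close>

text \<open>
  An occurrence of a square \<open>u u\<close> is identified by its (0-based) starting position and by the
  length of \<open>u\<close>.
\<close>

definition tandem_repeats :: "'a list \<Rightarrow> (nat \<times> nat) set" where
  "tandem_repeats T = {(length x, length u) | x u y. u \<noteq> [] \<and> T = x @ u @ u @ y}"

definition occ :: "'a list \<Rightarrow> nat" where
  "occ T = card (tandem_repeats T)"

section \<open>A word RAM with read-only input\<close>

text \<open>
  Words are the natural numbers below \<open>2 ^ w\<close>; the word length \<open>w\<close> is a parameter of the semantics,
  not of the program. A program is a finite list of unit-cost instructions over registers and over
  named arrays of working memory; both kinds of names are fixed in the program text, so every program
  has a constant number of them. Having several arrays, each addressed by a single word, allows
  \<open>O(n)\<close> words to be addressed even if \<open>2 ^ w\<close> is barely larger than \<open>n\<close>. The input string can only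
  be read, the output can only be appended to.
\<close>

datatype binop = Add | Sub | Mul | Div | Mod | And | Or | Xor | Shl | Shr

datatype instr =
    Const nat nat             \<comment> \<open>\<open>Const r k\<close>: \<open>r := k\<close>\<close>
  | Op binop nat nat nat      \<comment> \<open>\<open>Op f r x y\<close>: \<open>r := f x y\<close>\<close>
  | Input nat nat             \<comment> \<open>\<open>Input r x\<close>: \<open>r := T[x]\<close>\<close>
  | Load nat nat nat          \<comment> \<open>\<open>Load r a x\<close>: \<open>r := a[x]\<close>\<close>
  | Store nat nat nat         \<comment> \<open>\<open>Store a x r\<close>: \<open>a[x] := r\<close>\<close>
  | Random nat                \<comment> \<open>\<open>Random r\<close>: \<open>r\<close> becomes a fresh uniformly random word\<close>
  | Report nat nat            \<comment> \<open>\<open>Report x y\<close>: append \<open>(x, y)\<close> to the output\<close>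
  | Jump nat
  | Jump_Less nat nat nat     \<comment> \<open>\<open>Jump_Less x y l\<close>: if \<open>x < y\<close> then go to \<open>l\<close>\<close>

type_synonym program = "instr list"

record config =
  pc :: nat
  reg :: "nat \<Rightarrow> nat"
  mem :: "nat \<Rightarrow> nat \<Rightarrow> nat"
  extent :: "nat \<Rightarrow> nat"
  reported :: "(nat \<times> nat) list"

fun eval_op :: "nat \<Rightarrow> binop \<Rightarrow> nat \<Rightarrow> nat \<Rightarrow> nat" where
  "eval_op w Add x y = (x + y) mod 2 ^ w"
| "eval_op w Sub x y = (x + 2 ^ w - y) mod 2 ^ w"
| "eval_op w Mul x y = (x * y) mod 2 ^ w"
| "eval_op w Div x y = x div y"
| "eval_op w Mod x y = x mod y"
| "eval_op w And x y = and x y"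
| "eval_op w Or x y = or x y"
| "eval_op w Xor x y = xor x y"
| "eval_op w Shl x y = (x * 2 ^ y) mod 2 ^ w"
| "eval_op w Shr x y = x div 2 ^ y"

definition set_reg :: "nat \<Rightarrow> nat \<Rightarrow> config \<Rightarrow> config" where
  "set_reg r v s = s\<lparr>reg := (reg s)(r := v), pc := Suc (pc s)\<rparr>"

text \<open>\<open>extent s a\<close> is the number of cells of array \<open>a\<close> up to the highest one accessed so far.\<close>

definition touch :: "nat \<Rightarrow> nat \<Rightarrow> config \<Rightarrow> config" where
  "touch a i s = s\<lparr>extent := (extent s)(a := max (extent s a) (Suc i))\<rparr>"

fun exec :: "nat \<Rightarrow> nat list \<Rightarrow> instr \<Rightarrow> config \<Rightarrow> config pmf" where
  "exec w T (Const r k) s = return_pmf (set_reg r (k mod 2 ^ w) s)"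
| "exec w T (Op f r x y) s = return_pmf (set_reg r (eval_op w f (reg s x) (reg s y)) s)"
| "exec w T (Input r x) s =
     return_pmf (set_reg r (if reg s x < length T then T ! reg s x else 0) s)"
| "exec w T (Load r a x) s =
     return_pmf (set_reg r (mem s a (reg s x)) (touch a (reg s x) s))"
| "exec w T (Store a x r) s =
     return_pmf ((touch a (reg s x) s)
       \<lparr>mem := (mem s)(a := (mem s a)(reg s x := reg s r)), pc := Suc (pc s)\<rparr>)"
| "exec w T (Random r) s = map_pmf (\<lambda>v. set_reg r v s) (pmf_of_set {..<2 ^ w})"
| "exec w T (Report x y) s =
     return_pmf (s\<lparr>reported := reported s @ [(reg s x, reg s y)], pc := Suc (pc s)\<rparr>)"
| "exec w T (Jump l) s = return_pmf (s\<lparr>pc := l\<rparr>)"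
| "exec w T (Jump_Less x y l) s =
     return_pmf (s\<lparr>pc := (if reg s x < reg s y then l else Suc (pc s))\<rparr>)"

definition halted :: "program \<Rightarrow> config \<Rightarrow> bool" where
  "halted P s \<longleftrightarrow> length P \<le> pc s"

definition step :: "nat \<Rightarrow> nat list \<Rightarrow> program \<Rightarrow> config \<Rightarrow> config pmf" where
  "step w T P s = (if halted P s then return_pmf s else exec w T (P ! pc s) s)"

text \<open>The length of the string and the parameter are passed in registers 0 and 1.\<close>

definition start :: "nat list \<Rightarrow> nat \<Rightarrow> config" where
  "start T \<tau> =
     \<lparr>pc = 0, reg = (\<lambda>_. 0)(0 := length T, 1 := \<tau>), mem = (\<lambda>_ _. 0), extent = (\<lambda>_. 0), reported = []\<rparr>"

primrec run :: "nat \<Rightarrow> nat list \<Rightarrow> nat \<Rightarrow> program \<Rightarrow> nat \<Rightarrow> config pmf" where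
  "run w T \<tau> P 0 = return_pmf (start T \<tau>)"
| "run w T \<tau> P (Suc t) = bind_pmf (run w T \<tau> P t) (step w T P)"

text \<open>
  Only the finitely many arrays named in the program can have a nonzero extent, so the sum below
  ranges over a finite set in every reachable configuration. Input and output are not counted, and
  neither is the constant number of registers of the program.
\<close>

definition words_used :: "config \<Rightarrow> nat" where
  "words_used s = (\<Sum>a | extent s a \<noteq> 0. extent s a)"

section \<open>Solving the tandem repeats problem\<close>

definition valid_input :: "nat \<Rightarrow> nat list \<Rightarrow> nat \<Rightarrow> bool" where
  "valid_input w T \<tau> \<longleftrightarrow>
     1 \<le> \<tau> \<and> \<tau> \<le> length T \<and> length T < 2 ^ w \<and> set T \<subseteq> {..<2 ^ w}"

text \<open>
  Every possible run that halts reports each tandem repeat exactly once (in any order), and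
  the program halts almost surely.
\<close>

definition solves_tandem_repeats :: "nat \<Rightarrow> nat list \<Rightarrow> nat \<Rightarrow> program \<Rightarrow> bool" where
  "solves_tandem_repeats w T \<tau> P \<longleftrightarrow>
     (\<forall>t. \<forall>s \<in> set_pmf (run w T \<tau> P t). halted P s \<longrightarrow>
        distinct (reported s) \<and> set (reported s) = tandem_repeats T) \<and>
     (\<lambda>t. measure_pmf.prob (run w T \<tau> P t) {s. halted P s}) \<longlonglongrightarrow> 1"

definition in_space :: "nat \<Rightarrow> nat list \<Rightarrow> nat \<Rightarrow> program \<Rightarrow> real \<Rightarrow> bool" where
  "in_space w T \<tau> P b \<longleftrightarrow>
     (\<forall>t. \<forall>s \<in> set_pmf (run w T \<tau> P t). real (words_used s) \<le> b)"

definition in_time :: "nat \<Rightarrow> nat list \<Rightarrow> nat \<Rightarrow> program \<Rightarrow> real \<Rightarrow> bool" where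
  "in_time w T \<tau> P b \<longleftrightarrow>
     (\<exists>t. real t \<le> b \<and> (\<forall>s \<in> set_pmf (run w T \<tau> P t). halted P s))"

definition in_time_with_prob :: "nat \<Rightarrow> nat list \<Rightarrow> nat \<Rightarrow> program \<Rightarrow> real \<Rightarrow> real \<Rightarrow> bool" where
  "in_time_with_prob w T \<tau> P b q \<longleftrightarrow>
     (\<exists>t. real t \<le> b \<and> measure_pmf.prob (run w T \<tau> P t) {s. halted P s} \<ge> q)"

end

theory Submission
  imports Defs
begin

text \<open>
  One deterministic program serves both parts. With \<open>S = n div \<tau>\<close> it uses \<open>O(S)\<close> words and time
  \<open>O(n log n + n \<tau> + occ)\<close>. For a period \<open>p\<close> call a position \<open>q\<close> good if \<open>T[q] = T[q + p]\<close>; the squares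
  with period \<open>p\<close> are the windows of \<open>p\<close> consecutive good positions, so it suffices to find the maximal
  runs of at least \<open>p\<close> good positions.

  Periods are treated in batches \<open>lo, \<dots>, lo + m - 1\<close> with \<open>m = min lo S\<close>, and the positions in blocks of
  length \<open>m\<close>. As \<open>m \<le> p\<close>, a run of length \<open>p\<close> is never strictly inside a block, hence all that matters
  about a block and a period is its first and its last bad position. For one block and all periods
  of the batch these are the longest common extensions of the block with all shifts of a text window of
  length \<open>2 m\<close>, which the Z-algorithm computes in time \<open>O(m)\<close>, once forwards and once backwards. A batch
  costs \<open>O(n)\<close>. While \<open>lo < S\<close> every batch doubles \<open>lo\<close>, afterwards it adds \<open>S\<close> to \<open>lo\<close>, so there are
  \<open>O(log n + \<tau>)\<close> batches.
\<close>

section \<open>Structured programs\<close>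

text \<open>\<open>While h x y c\<close> runs \<open>h\<close> before every test. The only test
  available compares two registers, so \<open>h\<close> is the place where a composite condition is
  evaluated.\<close>

datatype com =
    Skip
  | Atom instr
  | Seq com com (infixr \<open>;;\<close> 60)
  | Cond nat nat com com
  | While com nat nat com

primrec clen :: "com \<Rightarrow> nat" where
  "clen Skip = 0"
| "clen (Atom i) = 1"
| "clen (c ;; d) = clen c + clen d"
| "clen (Cond x y c d) = clen c + clen d + 2"
| "clen (While h x y c) = clen h + clen c + 3"

text \<open>The argument \<open>p\<close> is the address of the first instruction, because jump
  targets are absolute. A conditional lays out its else branch first: the conditional jump leads to
  the then branch, and an unconditional jump skips it.\<close>

primrec code :: "com \<Rightarrow> nat \<Rightarrow> program" where
  "code Skip p = []"
| "code (Atom i) p = [i]"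
| "code (c ;; d) p = code c p @ code d (p + clen c)"
| "code (Cond x y c d) p =
     Jump_Less x y (p + clen d + 2) # code d (p + 1) @
     Jump (p + clen d + clen c + 2) # code c (p + clen d + 2)"
| "code (While h x y c) p =
     code h p @ Jump_Less x y (p + clen h + 2) # Jump (p + clen h + clen c + 3) #
     code c (p + clen h + 2) @ [Jump p]"

lemma length_code [simp]: "length (code c p) = clen c"
  by (induction c arbitrary: p) auto

fun straight :: "instr \<Rightarrow> bool" where
  "straight (Random r) = False"
| "straight (Jump l) = False"
| "straight (Jump_Less x y l) = False"
| "straight i = True"

text \<open>For a straight instruction the support of \<open>exec\<close> is a singleton, so
  \<open>the_elem\<close> extracts the unique successor.\<close>

definition eff :: "nat \<Rightarrow> nat list \<Rightarrow> instr \<Rightarrow> config \<Rightarrow> config" where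
  "eff w T i s = the_elem (set_pmf (exec w T i s))"

definition inp :: "nat list \<Rightarrow> nat \<Rightarrow> nat" where
  "inp T q = (if q < length T then T ! q else 0)"

lemma eff_simps:
  "eff w T (Const r k) s = set_reg r (k mod 2 ^ w) s"
  "eff w T (Op f r x y) s = set_reg r (eval_op w f (reg s x) (reg s y)) s"
  "eff w T (Input r x) s = set_reg r (inp T (reg s x)) s"
  "eff w T (Load r a x) s = set_reg r (mem s a (reg s x)) (touch a (reg s x) s)"
  "eff w T (Store a x r) s = (touch a (reg s x) s)
     \<lparr>mem := (mem s)(a := (mem s a)(reg s x := reg s r)), pc := Suc (pc s)\<rparr>"
  "eff w T (Report x y) s = s\<lparr>reported := reported s @ [(reg s x, reg s y)], pc := Suc (pc s)\<rparr>"
  by (simp_all add: eff_def inp_def)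

lemma exec_straight: "straight i \<Longrightarrow> exec w T i s = return_pmf (eff w T i s)"
  by (cases i) (simp_all add: eff_def)

lemma pc_eff [simp]: "straight i \<Longrightarrow> pc (eff w T i s) = Suc (pc s)"
  by (cases i) (simp_all add: eff_simps set_reg_def touch_def)

lemma eff_pc_update:
  "straight i \<Longrightarrow> eff w T i (s\<lparr>pc := q\<rparr>) = (eff w T i s)\<lparr>pc := Suc q\<rparr>"
  by (cases i) (simp_all add: eff_simps set_reg_def touch_def)

text \<open>Charges the jumps that compilation inserts: one for each test, one for skipping the then
  branch, one for jumping back to the loop header, and two in total for leaving a loop.\<close>

definition tick :: "nat \<Rightarrow> config \<Rightarrow> config" where
  "tick k s = s\<lparr>pc := pc s + k\<rparr>"

lemma tick_simps [simp]:
  "pc (tick k s) = pc s + k" "reg (tick k s) = reg s" "mem (tick k s) = mem s"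
  "extent (tick k s) = extent s" "reported (tick k s) = reported s"
  "(tick k s)\<lparr>pc := q\<rparr> = s\<lparr>pc := q\<rparr>"
  by (simp_all add: tick_def)

text \<open>In the structured semantics the component \<open>pc\<close> has no meaning as a position; it counts the
  steps that the compiled program takes.\<close>

inductive big :: "nat \<Rightarrow> nat list \<Rightarrow> com \<Rightarrow> config \<Rightarrow> config \<Rightarrow> bool" for w T where
  Skip: "big w T Skip s s"
| Atom: "straight i \<Longrightarrow> big w T (Atom i) s (eff w T i s)"
| Seq: "big w T c s s' \<Longrightarrow> big w T d s' s'' \<Longrightarrow> big w T (c ;; d) s s''"
| CondT: "reg s x < reg s y \<Longrightarrow> big w T c (tick 1 s) s' \<Longrightarrow> big w T (Cond x y c d) s s'"
| CondF: "\<not> reg s x < reg s y \<Longrightarrow> big w T d (tick 1 s) s' \<Longrightarrow>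
    big w T (Cond x y c d) s (tick 1 s')"
| WhileT: "big w T h s s1 \<Longrightarrow> reg s1 x < reg s1 y \<Longrightarrow> big w T c (tick 1 s1) s2 \<Longrightarrow>
    big w T (While h x y c) (tick 1 s2) s3 \<Longrightarrow> big w T (While h x y c) s s3"
| WhileF: "big w T h s s1 \<Longrightarrow> \<not> reg s1 x < reg s1 y \<Longrightarrow> big w T (While h x y c) s (tick 2 s1)"

section \<open>Correctness of compilation, and transfer to the probabilistic semantics\<close>

definition step_rel :: "nat \<Rightarrow> nat list \<Rightarrow> program \<Rightarrow> config rel" where
  "step_rel w T P = {(s, s'). step w T P s = return_pmf s'}"

lemma step_relI:
  assumes "pc s = length pre" "P = pre @ i # post" "exec w T i s = return_pmf s'"
  shows "(s, s') \<in> step_rel w T P"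
  using assms by (simp add: step_rel_def step_def halted_def)

lemma relpow_comp: "(a, b) \<in> R ^^ i \<Longrightarrow> (b, c) \<in> R ^^ j \<Longrightarrow> (a, c) \<in> R ^^ (i + j)"
  for R :: "'a rel"
  by (auto simp: relpow_add)

lemma relpow_1: "(a, b) \<in> R \<Longrightarrow> (a, b) \<in> R ^^ Suc 0"
  for R :: "'a rel"
  by auto

text \<open>Induction on the derivation. \<open>pre\<close> and \<open>post\<close> are arbitrary
  because the code of a subprogram sits inside that of its context. As \<open>pc\<close> counts
  steps in the structured semantics, the difference of the two counters is the exact number of
  machine steps.\<close>

lemma big_steps:
  assumes "big w T c s s'" "P = pre @ code c (length pre) @ post"
  shows "pc s \<le> pc s' \<and>
    (s\<lparr>pc := length pre\<rparr>, s'\<lparr>pc := length pre + clen c\<rparr>) \<in> step_rel w T P ^^ (pc s' - pc s)"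
  using assms
proof (induction arbitrary: pre post rule: big.induct)
  case (Skip s)
  then show ?case by simp
next
  case (Atom i s)
  have "(s\<lparr>pc := length pre\<rparr>, (eff w T i s)\<lparr>pc := Suc (length pre)\<rparr>) \<in> step_rel w T P"
    using Atom by (intro step_relI[where i = i and pre = pre and post = post])
      (simp_all add: exec_straight eff_pc_update)
  with Atom show ?case by simp
next
  case (Seq c s s' d s'')
  from Seq.IH(1)[of pre "code d (length pre + clen c) @ post"] Seq.prems
  have 1: "pc s \<le> pc s'" "(s\<lparr>pc := length pre\<rparr>, s'\<lparr>pc := length pre + clen c\<rparr>)
    \<in> step_rel w T P ^^ (pc s' - pc s)" by auto
  from Seq.IH(2)[of "pre @ code c (length pre)" "post"] Seq.prems
  have 2: "pc s' \<le> pc s''" "(s'\<lparr>pc := length pre + clen c\<rparr>, s''\<lparr>pc := length pre + clen c + clen d\<rparr>)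
    \<in> step_rel w T P ^^ (pc s'' - pc s')" by auto
  have "pc s' - pc s + (pc s'' - pc s') = pc s'' - pc s" using 1(1) 2(1) by simp
  then show ?case using relpow_comp[OF 1(2) 2(2)] 1(1) 2(1) by (simp add: add.assoc)
next
  case (CondT s x y c s' d)
  let ?p = "length pre"
  have 1: "(s\<lparr>pc := ?p\<rparr>, s\<lparr>pc := ?p + clen d + 2\<rparr>) \<in> step_rel w T P"
    using CondT.hyps CondT.prems by (intro step_relI[where pre = pre]) auto
  from CondT.IH[of "pre @ Jump_Less x y (?p + clen d + 2) # code d (?p + 1) @
     [Jump (?p + clen d + clen c + 2)]" post] CondT.prems
  have 2: "Suc (pc s) \<le> pc s'" "(s\<lparr>pc := ?p + clen d + 2\<rparr>, s'\<lparr>pc := ?p + clen d + 2 + clen c\<rparr>)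
      \<in> step_rel w T P ^^ (pc s' - Suc (pc s))" by auto
  have "Suc 0 + (pc s' - Suc (pc s)) = pc s' - pc s" using 2(1) by simp
  then show ?case using relpow_comp[OF relpow_1[OF 1] 2(2)] 2(1) by (simp add: add_ac)
next
  case (CondF s x y d s' c)
  let ?p = "length pre"
  have 1: "(s\<lparr>pc := ?p\<rparr>, s\<lparr>pc := ?p + 1\<rparr>) \<in> step_rel w T P"
    using CondF.hyps CondF.prems by (intro step_relI[where pre = pre]) auto
  from CondF.IH[of "pre @ [Jump_Less x y (?p + clen d + 2)]"
     "Jump (?p + clen d + clen c + 2) # code c (?p + clen d + 2) @ post"] CondF.prems
  have 2: "Suc (pc s) \<le> pc s'" "(s\<lparr>pc := ?p + 1\<rparr>, s'\<lparr>pc := ?p + 1 + clen d\<rparr>)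
      \<in> step_rel w T P ^^ (pc s' - Suc (pc s))" by auto
  have 3: "(s'\<lparr>pc := ?p + 1 + clen d\<rparr>, s'\<lparr>pc := ?p + clen d + clen c + 2\<rparr>) \<in> step_rel w T P"
    using CondF.prems
    by (intro step_relI[where pre = "pre @ Jump_Less x y (?p + clen d + 2) # code d (?p + 1)"]) auto
  have "Suc 0 + (pc s' - Suc (pc s)) + Suc 0 = Suc (pc s') - pc s" using 2(1) by simp
  then show ?case
    using relpow_comp[OF relpow_comp[OF relpow_1[OF 1] 2(2)] relpow_1[OF 3]] 2(1)
    by (simp add: add_ac)
next
  case (WhileT h s s1 x y c s2 s3)
  let ?p = "length pre"
  from WhileT.IH(1)[of pre "Jump_Less x y (?p + clen h + 2) # Jump (?p + clen h + clen c + 3) #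
     code c (?p + clen h + 2) @ Jump ?p # post"] WhileT.prems
  have 1: "pc s \<le> pc s1" "(s\<lparr>pc := ?p\<rparr>, s1\<lparr>pc := ?p + clen h\<rparr>)
      \<in> step_rel w T P ^^ (pc s1 - pc s)" by auto
  have 2: "(s1\<lparr>pc := ?p + clen h\<rparr>, s1\<lparr>pc := ?p + clen h + 2\<rparr>) \<in> step_rel w T P"
    using WhileT.hyps WhileT.prems by (intro step_relI[where pre = "pre @ code h ?p"]) auto
  from WhileT.IH(2)[of "pre @ code h ?p @ [Jump_Less x y (?p + clen h + 2),
      Jump (?p + clen h + clen c + 3)]" "Jump ?p # post"] WhileT.prems
  have 3: "Suc (pc s1) \<le> pc s2" "(s1\<lparr>pc := ?p + clen h + 2\<rparr>, s2\<lparr>pc := ?p + clen h + 2 + clen c\<rparr>)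
      \<in> step_rel w T P ^^ (pc s2 - Suc (pc s1))" by auto
  \<comment> \<open>The closing jump returns to the loop header, so the last induction hypothesis
    applies with the same \<open>pre\<close> and \<open>post\<close>.\<close>
  have 4: "(s2\<lparr>pc := ?p + clen h + 2 + clen c\<rparr>, s2\<lparr>pc := ?p\<rparr>) \<in> step_rel w T P"
    using WhileT.prems
    by (intro step_relI[where pre = "pre @ code h ?p @ Jump_Less x y (?p + clen h + 2) #
      Jump (?p + clen h + clen c + 3) # code c (?p + clen h + 2)"]) auto
  from WhileT.IH(3)[OF WhileT.prems]
  have 5: "Suc (pc s2) \<le> pc s3" "(s2\<lparr>pc := ?p\<rparr>, s3\<lparr>pc := ?p + clen (While h x y c)\<rparr>)
      \<in> step_rel w T P ^^ (pc s3 - Suc (pc s2))" by auto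
  have "pc s1 - pc s + Suc 0 + (pc s2 - Suc (pc s1)) + Suc 0 + (pc s3 - Suc (pc s2)) = pc s3 - pc s"
    using 1(1) 3(1) 5(1) by simp
  then show ?case
    using relpow_comp[OF relpow_comp[OF relpow_comp[OF relpow_comp[OF 1(2) relpow_1[OF 2]] 3(2)]
      relpow_1[OF 4]] 5(2)] 1(1) 3(1) 5(1) by simp
next
  case (WhileF h s s1 x y c)
  let ?p = "length pre"
  from WhileF.IH[of pre "Jump_Less x y (?p + clen h + 2) # Jump (?p + clen h + clen c + 3) #
     code c (?p + clen h + 2) @ Jump ?p # post"] WhileF.prems
  have 1: "pc s \<le> pc s1" "(s\<lparr>pc := ?p\<rparr>, s1\<lparr>pc := ?p + clen h\<rparr>)
      \<in> step_rel w T P ^^ (pc s1 - pc s)" by auto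
  have 2: "(s1\<lparr>pc := ?p + clen h\<rparr>, s1\<lparr>pc := ?p + clen h + 1\<rparr>) \<in> step_rel w T P"
    using WhileF.hyps WhileF.prems by (intro step_relI[where pre = "pre @ code h ?p"]) auto
  have 3: "(s1\<lparr>pc := ?p + clen h + 1\<rparr>, s1\<lparr>pc := ?p + clen h + clen c + 3\<rparr>) \<in> step_rel w T P"
    using WhileF.prems
    by (intro step_relI[where pre = "pre @ code h ?p @ [Jump_Less x y (?p + clen h + 2)]"]) auto
  have "pc s1 - pc s + Suc 0 + Suc 0 = pc s1 + 2 - pc s" using 1(1) by simp
  then show ?case
    using relpow_comp[OF relpow_comp[OF 1(2) relpow_1[OF 2]] relpow_1[OF 3]] 1(1)
    by (simp add: add_ac)
qed

lemma run_deterministic: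
  assumes "(start T \<tau>, s) \<in> step_rel w T P ^^ t"
  shows "run w T \<tau> P t = return_pmf s"
  using assms
proof (induction t arbitrary: s)
  case (Suc t)
  then obtain s1 where "(start T \<tau>, s1) \<in> step_rel w T P ^^ t" "(s1, s) \<in> step_rel w T P"
    by auto
  with Suc.IH show ?case by (simp add: step_rel_def bind_return_pmf)
qed simp

lemma step_rel_extent_mono: "(s, s') \<in> step_rel w T P \<Longrightarrow> extent s a \<le> extent s' a"
proof -
  assume "(s, s') \<in> step_rel w T P"
  then have "s' \<in> set_pmf (step w T P s)" by (simp add: step_rel_def)
  then show ?thesis
    by (cases "P ! pc s") (auto simp: step_def set_reg_def touch_def split: if_splits)
qed

lemma steps_extent_mono: "(s, s') \<in> step_rel w T P ^^ t \<Longrightarrow> extent s a \<le> extent s' a"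
proof (induction t arbitrary: s')
  case (Suc t)
  then obtain s1 where "(s, s1) \<in> step_rel w T P ^^ t" "(s1, s') \<in> step_rel w T P" by auto
  with Suc.IH[of s1] step_rel_extent_mono[of s1 s' w T P a] show ?case by simp
qed simp

text \<open>At any time the run is a point mass. Before \<open>t0\<close> it lies on the path to
  \<open>s\<close>, where extents only grow; a halted configuration is a fixed point, so one that
  occurs on this path is already \<open>s\<close>.\<close>

lemma deterministic_run_cases:
  assumes "(start T \<tau>, s) \<in> step_rel w T P ^^ t0" "halted P s"
  shows "\<exists>s'. run w T \<tau> P t = return_pmf s' \<and> (\<forall>a. extent s' a \<le> extent s a) \<and>
    (halted P s' \<or> t0 \<le> t \<longrightarrow> s' = s)"
proof -
  have stay: "halted P x \<Longrightarrow> (x, y) \<in> step_rel w T P ^^ k \<longleftrightarrow> y = x" for x y k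
    by (induction k arbitrary: y) (auto simp: step_rel_def step_def relcomp_unfold)
  show ?thesis
  proof (cases "t0 \<le> t")
    case True
    have "(start T \<tau>, s) \<in> step_rel w T P ^^ (t0 + (t - t0))"
      using relpow_comp[OF assms(1)] stay[OF assms(2)] by blast
    with True have "run w T \<tau> P t = return_pmf s" by (intro run_deterministic) simp
    then show ?thesis by auto
  next
    case False
    then have "(start T \<tau>, s) \<in> step_rel w T P ^^ (t + (t0 - t))" using assms(1) by simp
    then obtain s' where s': "(start T \<tau>, s') \<in> step_rel w T P ^^ t"
      "(s', s) \<in> step_rel w T P ^^ (t0 - t)" by (auto simp: relpow_add)
    show ?thesis
      using run_deterministic[OF s'(1)] steps_extent_mono[OF s'(2)] stay[of s' s] s'(2) False
      by (intro exI[of _ s']) auto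
  qed
qed

text \<open>One structured run settles all requirements: its final extents bound the space at every
  time, and from step \<open>pc s\<close> on the run is a point mass at a halted configuration, so
  the probability of having halted is 1.\<close>

lemma big_program:
  fixes w T \<tau> c s
  assumes "big w T c (start T \<tau>) s"
  defines "P \<equiv> code c 0"
  assumes "distinct (reported s)" "set (reported s) = tandem_repeats T"
  shows "solves_tandem_repeats w T \<tau> P"
    and "finite A \<Longrightarrow> (\<And>a. a \<notin> A \<Longrightarrow> extent s a = 0) \<Longrightarrow> (\<And>a. a \<in> A \<Longrightarrow> extent s a \<le> S) \<Longrightarrow>
      real (card A * S) \<le> b \<Longrightarrow> in_space w T \<tau> P b"
    and "real (pc s) \<le> b \<Longrightarrow> in_time w T \<tau> P b"
    and "real (pc s) \<le> b \<Longrightarrow> q \<le> 1 \<Longrightarrow> in_time_with_prob w T \<tau> P b q"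
proof -
  let ?s = "s\<lparr>pc := length P\<rparr>"
  have "(start T \<tau>, ?s) \<in> step_rel w T P ^^ pc s"
    using big_steps[OF assms(1), of P "[]" "[]"] by (simp add: P_def start_def)
  then have "\<exists>s'. run w T \<tau> P t = return_pmf s' \<and> (\<forall>a. extent s' a \<le> extent ?s a) \<and>
    (halted P s' \<or> pc s \<le> t \<longrightarrow> s' = ?s)" for t
    by (rule deterministic_run_cases) (simp add: halted_def)
  then obtain f where f: "\<And>t. run w T \<tau> P t = return_pmf (f t)"
    "\<And>t a. extent (f t) a \<le> extent ?s a" "\<And>t. halted P (f t) \<Longrightarrow> f t = ?s"
    "\<And>t. pc s \<le> t \<Longrightarrow> f t = ?s"
    by meson
  have halt: "halted P ?s" by (simp add: halted_def)
  have late: "run w T \<tau> P t = return_pmf ?s" if "pc s \<le> t" for t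
    using f(1)[of t] f(4)[OF that] by simp
  have late_prob: "measure_pmf.prob (run w T \<tau> P t) {s. halted P s} = 1" if "pc s \<le> t" for t
    by (simp add: late[OF that] halt)
  have "distinct (reported s') \<and> set (reported s') = tandem_repeats T"
    if "s' \<in> set_pmf (run w T \<tau> P t)" "halted P s'" for t s'
    using that assms(3,4) f(3)[of t] by (simp add: f(1))
  moreover have "(\<lambda>t. measure_pmf.prob (run w T \<tau> P t) {s. halted P s}) \<longlonglongrightarrow> 1"
    by (rule tendsto_eventually, rule eventually_sequentiallyI[of "pc s"]) (rule late_prob)
  ultimately show "solves_tandem_repeats w T \<tau> P"
    by (auto simp: solves_tandem_repeats_def)
  show "in_time w T \<tau> P b" if "real (pc s) \<le> b"
    unfolding in_time_def using that halt by (intro exI[of _ "pc s"]) (simp add: late)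
  show "in_time_with_prob w T \<tau> P b q" if "real (pc s) \<le> b" "q \<le> 1"
    unfolding in_time_with_prob_def using that by (intro exI[of _ "pc s"]) (simp add: late_prob)
  show "in_space w T \<tau> P b"
    if A: "finite A" "\<And>a. a \<notin> A \<Longrightarrow> extent s a = 0" "\<And>a. a \<in> A \<Longrightarrow> extent s a \<le> S"
      and b: "real (card A * S) \<le> b"
    unfolding in_space_def
  proof (intro allI ballI)
    fix t s'
    assume s': "s' \<in> set_pmf (run w T \<tau> P t)"
    have le: "extent s' a \<le> extent s a" for a
      using s' f(2)[of t a] by (simp add: f(1))
    have "a \<in> A" if "extent s' a \<noteq> 0" for a
      using that A(2)[of a] le[of a] by (cases "a \<in> A") auto
    then have "words_used s' = (\<Sum>a\<in>A. extent s' a)"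
      unfolding words_used_def using A(1) by (intro sum.mono_neutral_left) auto
    also have "\<dots> \<le> (\<Sum>a\<in>A. S)"
      by (intro sum_mono le_trans[OF le A(3)])
    finally have "words_used s' \<le> card A * S" by simp
    then have "real (words_used s') \<le> real (card A * S)" by (rule of_nat_mono)
    with b show "real (words_used s') \<le> b" by linarith
  qed
qed

section \<open>Weakest preconditions\<close>

definition wp :: "nat \<Rightarrow> nat list \<Rightarrow> com \<Rightarrow> (config \<Rightarrow> bool) \<Rightarrow> config \<Rightarrow> bool" where
  "wp w T c Q s \<longleftrightarrow> (\<exists>s'. big w T c s s' \<and> Q s')"

inductive_cases big_elims:
  "big w T Skip s s'" "big w T (Atom i) s s'" "big w T (c ;; d) s s'" "big w T (Cond x y c d) s s'"

lemma wp_Skip: "wp w T Skip Q s \<longleftrightarrow> Q s"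
  and wp_Atom: "straight i \<Longrightarrow> wp w T (Atom i) Q s \<longleftrightarrow> Q (eff w T i s)"
  and wp_Seq: "wp w T (c ;; d) Q s \<longleftrightarrow> wp w T c (wp w T d Q) s"
  unfolding wp_def by (auto intro: big.intros elim!: big_elims)

lemma wp_Cond:
  "wp w T (Cond x y c d) Q s \<longleftrightarrow>
     (if reg s x < reg s y then wp w T c Q (tick 1 s) else wp w T d (\<lambda>s'. Q (tick 1 s')) (tick 1 s))"
proof (cases "reg s x < reg s y")
  case True
  have "big w T (Cond x y c d) s s' \<longleftrightarrow> big w T c (tick 1 s) s'" for s'
    using True CondT[OF True] by (auto elim!: big_elims)
  with True show ?thesis by (simp add: wp_def)
next
  case False
  have "big w T (Cond x y c d) s s' \<longleftrightarrow> (\<exists>s1. s' = tick 1 s1 \<and> big w T d (tick 1 s) s1)" for s'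
    using False CondF[OF False] by (auto elim!: big_elims)
  with False show ?thesis by (auto simp: wp_def)
qed

text \<open>Total correctness by induction on the measure \<open>\<mu>\<close>. The invariant is
  required before the header \<open>h\<close>, and the two ticks of an iteration are the test and
  the jump back.\<close>

lemma wp_while:
  fixes \<mu> :: "config \<Rightarrow> nat"
  assumes "I s"
    and "\<And>s. I s \<Longrightarrow> wp w T h (\<lambda>s1. if reg s1 x < reg s1 y
        then wp w T c (\<lambda>s2. I (tick 1 s2) \<and> \<mu> (tick 1 s2) < \<mu> s) (tick 1 s1) else Q (tick 2 s1)) s"
  shows "wp w T (While h x y c) Q s"
  using assms(1)
proof (induction "\<mu> s" arbitrary: s rule: less_induct)
  case less
  from assms(2)[OF less.prems] obtain s1 where s1: "big w T h s s1"
    "if reg s1 x < reg s1 y then wp w T c (\<lambda>s2. I (tick 1 s2) \<and> \<mu> (tick 1 s2) < \<mu> s) (tick 1 s1)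
     else Q (tick 2 s1)" by (auto simp: wp_def)
  show ?case
  proof (cases "reg s1 x < reg s1 y")
    case True
    with s1(2) obtain s2 where s2: "big w T c (tick 1 s1) s2" "I (tick 1 s2)" "\<mu> (tick 1 s2) < \<mu> s"
      by (auto simp: wp_def)
    from less.hyps[OF s2(3,2)] obtain s3 where "big w T (While h x y c) (tick 1 s2) s3" "Q s3"
      by (auto simp: wp_def)
    then show ?thesis using WhileT[OF s1(1) True s2(1)] by (auto simp: wp_def)
  next
    case False
    with s1 WhileF[OF s1(1) False] show ?thesis by (auto simp: wp_def)
  qed
qed

section \<open>Longest common extensions\<close>

declare [[coercion Atom]]

definition set_mem :: "nat \<Rightarrow> nat \<Rightarrow> nat \<Rightarrow> config \<Rightarrow> config" where
  "set_mem a i v s = (touch a i s)\<lparr>mem := (mem s)(a := (mem s a)(i := v)), pc := Suc (pc s)\<rparr>"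

lemma eff_Store: "eff w T (Store a x r) s = set_mem a (reg s x) (reg s r) s"
  by (simp add: eff_simps set_mem_def)

lemma sel_simps [simp]:
  "pc (set_reg r v s) = Suc (pc s)" "reg (set_reg r v s) = (reg s)(r := v)"
  "mem (set_reg r v s) = mem s" "extent (set_reg r v s) = extent s"
  "reported (set_reg r v s) = reported s"
  "pc (touch a i s) = pc s" "reg (touch a i s) = reg s" "mem (touch a i s) = mem s"
  "extent (touch a i s) = (extent s)(a := max (extent s a) (Suc i))"
  "reported (touch a i s) = reported s"
  "pc (set_mem a i v s) = Suc (pc s)" "reg (set_mem a i v s) = reg s"
  "mem (set_mem a i v s) = (mem s)(a := (mem s a)(i := v))"
  "extent (set_mem a i v s) = (extent s)(a := max (extent s a) (Suc i))"
  "reported (set_mem a i v s) = reported s"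
  by (simp_all add: set_reg_def touch_def set_mem_def)

lemmas wp_simps = wp_Skip wp_Atom wp_Seq wp_Cond eff_simps(1-4) eff_simps(6) eff_Store

text \<open>
  Subroutines use higher register numbers than their callers, so that a frame condition is just a
  lower bound on the registers that may change. Array 0 holds the Z-table of the current block,
  arrays 1 and 2 hold its forward and backward extensions, and cell \<open>j\<close> of array 3 holds the length of
  the run of period \<open>lo + j\<close> that ends right before the current block.
\<close>

abbreviation (input) "rN \<equiv> 0 :: nat"
abbreviation (input) "rTau \<equiv> 1 :: nat"
abbreviation (input) "rZero \<equiv> 2 :: nat"
abbreviation (input) "rOne \<equiv> 3 :: nat"
abbreviation (input) "rS \<equiv> 4 :: nat"
abbreviation (input) "rLo \<equiv> 5 :: nat"
abbreviation (input) "rHi \<equiv> 6 :: nat"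
abbreviation (input) "rM \<equiv> 7 :: nat"
abbreviation (input) "rE \<equiv> 8 :: nat"
abbreviation (input) "rA \<equiv> 9 :: nat"
abbreviation (input) "rPx \<equiv> 10 :: nat"
abbreviation (input) "rPy \<equiv> 11 :: nat"
abbreviation (input) "rCnt \<equiv> 12 :: nat"
abbreviation (input) "rLim \<equiv> 13 :: nat"
abbreviation (input) "rI \<equiv> 14 :: nat"
abbreviation (input) "rL \<equiv> 15 :: nat"
abbreviation (input) "rR \<equiv> 16 :: nat"
abbreviation (input) "rK \<equiv> 17 :: nat"
abbreviation (input) "rU \<equiv> 18 :: nat"
abbreviation (input) "rV \<equiv> 19 :: nat"
abbreviation (input) "rX \<equiv> 20 :: nat"
abbreviation (input) "rY \<equiv> 21 :: nat"
abbreviation (input) "rC \<equiv> 22 :: nat"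

text \<open>A word or-ed with itself is copied without a reduction modulo \<open>2 ^ w\<close>, so
  no bound on the value has to be known.\<close>

abbreviation Move :: "nat \<Rightarrow> nat \<Rightarrow> instr" where
  "Move r x \<equiv> Op Or r x x"

definition frame :: "nat \<Rightarrow> config \<Rightarrow> config \<Rightarrow> bool" where
  "frame b s s' \<longleftrightarrow> (\<forall>r<b. reg s' r = reg s r)"

lemma frame_refl [simp]: "frame b s s"
  by (simp add: frame_def)

lemma frame_mono: "frame b s s' \<Longrightarrow> b' \<le> b \<Longrightarrow> frame b' s s'"
  by (simp add: frame_def)

definition same_mem :: "config \<Rightarrow> config \<Rightarrow> bool" where
  "same_mem s s' \<longleftrightarrow> mem s' = mem s \<and> extent s' = extent s \<and> reported s' = reported s"

text \<open>The disjunct \<open>k = 0\<close> is needed because \<open>i\<close> may lie beyond the end \<open>lm\<close> of the text.\<close>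

definition is_ext :: "(nat \<Rightarrow> nat) \<Rightarrow> (nat \<Rightarrow> nat) \<Rightarrow> nat \<Rightarrow> nat \<Rightarrow> nat \<Rightarrow> nat \<Rightarrow> bool" where
  "is_ext X Y m lm i k \<longleftrightarrow> k \<le> m \<and> (k = 0 \<or> i + k \<le> lm) \<and> (\<forall>t<k. X t = Y (i + t)) \<and>
     (k < m \<and> i + k < lm \<longrightarrow> X k \<noteq> Y (i + k))"

text \<open>Addresses are computed by \<open>f\<close>; with \<open>f = Sub\<close> pattern and text are read from right to left.\<close>

definition match_loop :: "binop \<Rightarrow> com" where
  "match_loop f = While
     (Const rC 0;;
      Cond rK rM
        (Op Add rV rI rK;;
         Cond rV rLim
           (Op f rX rPx rK;; Op f rY rPy rV;; Input rX rX;; Input rY rY;;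
            Cond rX rY Skip (Cond rY rX Skip (Const rC 1)))
           Skip)
        Skip)
     rZero rC (Op Add rK rK rOne)"

abbreviation chr :: "nat \<Rightarrow> nat list \<Rightarrow> binop \<Rightarrow> nat \<Rightarrow> nat \<Rightarrow> nat" where
  "chr w T f b t \<equiv> inp T (eval_op w f b t)"

text \<open>Every iteration except the last advances \<open>rK\<close>, whence 20 steps per new
  match and 20 more for the failing test. Equality of letters is decided by two strict comparisons.
  Nothing is compared below the initial \<open>rK\<close>, which may be a guess already known to
  match.\<close>

lemma wp_match_loop:
  assumes regs: "reg s rZero = 0" "reg s rOne = 1" "0 < w"
    and bounds: "reg s rK \<le> reg s rM" "reg s rI + reg s rM < 2 ^ w"
    and Q: "\<And>s'. frame rK s s' \<Longrightarrow> same_mem s s' \<Longrightarrow> reg s rK \<le> reg s' rK \<Longrightarrow> reg s' rK \<le> reg s rM \<Longrightarrow>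
      reg s' rK = reg s rK \<or> reg s rI + reg s' rK \<le> reg s rLim \<Longrightarrow>
      (\<And>t. reg s rK \<le> t \<Longrightarrow> t < reg s' rK \<Longrightarrow>
        chr w T f (reg s rPx) t = chr w T f (reg s rPy) (reg s rI + t)) \<Longrightarrow>
      (reg s' rK < reg s rM \<Longrightarrow> reg s rI + reg s' rK < reg s rLim \<Longrightarrow>
        chr w T f (reg s rPx) (reg s' rK) \<noteq> chr w T f (reg s rPy) (reg s rI + reg s' rK)) \<Longrightarrow>
      pc s' + 20 * reg s rK \<le> pc s + 20 + 20 * reg s' rK \<Longrightarrow> Q s'"
  shows "wp w T (match_loop f) Q s"
  unfolding match_loop_def
proof (rule wp_while[where I = "\<lambda>s'. frame rK s s' \<and> same_mem s s' \<and> reg s rK \<le> reg s' rK \<and>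
      reg s' rK \<le> reg s rM \<and> (reg s' rK = reg s rK \<or> reg s rI + reg s' rK \<le> reg s rLim) \<and>
      (\<forall>t. reg s rK \<le> t \<longrightarrow> t < reg s' rK \<longrightarrow>
        chr w T f (reg s rPx) t = chr w T f (reg s rPy) (reg s rI + t)) \<and>
      pc s' + 20 * reg s rK \<le> pc s + 20 * reg s' rK" and \<mu> = "\<lambda>s'. reg s rM - reg s' rK"],
      goal_cases)
  case 1
  show ?case using bounds by (simp add: same_mem_def)
next
  case (2 s')
  then have r: "reg s' rZero = 0" "reg s' rOne = 1" "reg s' rM = reg s rM" "reg s' rI = reg s rI"
    "reg s' rLim = reg s rLim" "reg s' rPx = reg s rPx" "reg s' rPy = reg s rPy"
    using regs by (simp_all add: frame_def)
  have m: "1 mod 2 ^ w = (1::nat)" using regs by simp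
  have small: "(reg s rI + reg s' rK) mod 2 ^ w = reg s rI + reg s' rK"
    "reg s' rK < reg s rM \<Longrightarrow> Suc (reg s' rK) mod 2 ^ w = Suc (reg s' rK)"
    using 2 bounds by simp_all
  let ?i = "reg s rI" and ?k = "reg s' rK"
  let ?x = "chr w T f (reg s rPx) ?k" and ?y = "chr w T f (reg s rPy) (?i + ?k)"
  show ?case
  proof (cases "?k < reg s rM \<and> ?i + ?k < reg s rLim \<and> ?x = ?y")
    case True
    show ?thesis
      using True
      apply (simp add: wp_simps r m small regs(3))
      using 2 True apply (auto simp: frame_def same_mem_def less_Suc_eq)
      done
  next
    case False
    \<comment> \<open>All branches that leave the loop change only registers from \<open>rU\<close>
      on, so this fact covers each of them.\<close>
    have *: "Q t" if "frame rU s' t" "same_mem s' t" "pc t \<le> pc s' + 20" for t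
      using that 2 False
      by (intro Q) (auto simp: frame_def same_mem_def)
    show ?thesis
      using False
      by (auto simp add: wp_simps r m small same_mem_def frame_def intro!: *)
  qed
qed


section \<open>The Z-algorithm and its amortised running time\<close>

lemma sub_mod: "y \<le> x \<Longrightarrow> x < 2 ^ w \<Longrightarrow> (x + 2 ^ w - y) mod 2 ^ w = x - y" for x y w :: nat
proof -
  assume "y \<le> x" "x < 2 ^ w"
  then have "x + 2 ^ w - y = (x - y) + 2 ^ w" by simp
  with \<open>x < 2 ^ w\<close> show ?thesis by (simp only: mod_add_self2) simp
qed

text \<open>The Z-box from \<open>rL\<close> to \<open>rR\<close> (exclusive) is a text segment
  known to equal a prefix of the pattern. Inside it, position \<open>i\<close> of the text looks
  like position \<open>i - l\<close> of the pattern, whose table entry, cut off at the end of the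
  box, is a safe first value.\<close>

definition guess :: com where
  "guess = (Const rK 0;;
     Cond rI rR
       (Op Sub rU rI rL;; Load rK 0 rU;; Op Sub rV rR rI;; Cond rV rK (Move rK rV) Skip)
       Skip)"

lemma wp_guess:
  assumes bounds: "reg s rL \<le> reg s rI" "reg s rI < 2 ^ w" "reg s rR < 2 ^ w"
    and Q: "\<And>s'. frame rK s s' \<Longrightarrow> mem s' = mem s \<Longrightarrow> reported s' = reported s \<Longrightarrow>
      reg s' rK = (if reg s rI < reg s rR
        then min (mem s 0 (reg s rI - reg s rL)) (reg s rR - reg s rI) else 0) \<Longrightarrow>
      extent s' = (if reg s rI < reg s rR
        then (extent s)(0 := max (extent s 0) (Suc (reg s rI - reg s rL))) else extent s) \<Longrightarrow>
      pc s' \<le> pc s + 10 \<Longrightarrow> Q s'"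
  shows "wp w T guess Q s"
  unfolding guess_def using bounds
  by (auto simp: wp_simps sub_mod frame_def intro!: Q)

text \<open>With \<open>out = 0\<close> the pattern is matched against itself and the table is
  filled; with another \<open>out\<close> a text is matched with the help of the finished table. The
  box is replaced only by one that ends further right.\<close>

definition zloop :: "binop \<Rightarrow> nat \<Rightarrow> com" where
  "zloop f out = (Const rL 0;; Const rR 0;;
     While Skip rI rCnt
       (guess;; match_loop f;; Op Add rU rI rK;; Cond rR rU (Move rL rI;; Move rR rU) Skip;;
        Store out rI rK;; Op Add rI rI rOne))"

text \<open>Self-matching starts at \<open>i0 \<ge> 1\<close>: this excludes the trivial box at 0,
  so that the entry \<open>i - l\<close> that is looked up has index at least 1 and has been
  computed before. Time is amortised against the right end of the box: 50 steps per position and 20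
  per advance of \<open>rR\<close>.\<close>

lemma wp_zloop:
  fixes s :: config and f w T
  defines "X \<equiv> chr w T f (reg s rPx)" and "Y \<equiv> chr w T f (reg s rPy)"
    and "i0 \<equiv> reg s rI" and "cnt \<equiv> reg s rCnt" and "m \<equiv> reg s rM" and "lm \<equiv> reg s rLim"
  assumes regs: "reg s rZero = 0" "reg s rOne = 1" "0 < w"
    and bounds: "cnt + m < 2 ^ w" "cnt \<le> m" "lm < 2 ^ w"
    and table: "\<And>k. 1 \<le> k \<Longrightarrow> k < m \<Longrightarrow> (out = 0 \<Longrightarrow> k < i0) \<Longrightarrow> is_ext X X m m k (mem s 0 k)"
    and self: "out = 0 \<Longrightarrow> 1 \<le> i0 \<and> X = Y \<and> lm = m"
    and Q: "\<And>s'. frame rI s s' \<Longrightarrow> reported s' = reported s \<Longrightarrow>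
      (\<And>a. a \<noteq> out \<Longrightarrow> mem s' a = mem s a) \<Longrightarrow>
      (\<And>i. i < i0 \<Longrightarrow> mem s' out i = mem s out i) \<Longrightarrow>
      (\<And>i. i0 \<le> i \<Longrightarrow> i < cnt \<Longrightarrow> is_ext X Y m lm i (mem s' out i)) \<Longrightarrow>
      (\<And>a. extent s' a \<le> (if a = 0 \<or> a = out then max (extent s a) m else extent s a)) \<Longrightarrow>
      pc s' \<le> pc s + 4 + 100 * m \<Longrightarrow> Q s'"
  shows "wp w T (zloop f out) Q s"
proof -
  \<comment> \<open>The bound \<open>lm\<close> on \<open>rR\<close> is guarded because an extension
    of length 0 may leave an empty box beyond the end of the text; such a box is never consulted,
    since the next position already lies to its right.\<close>
  define I where "I s' \<longleftrightarrow> frame rI s s' \<and> reported s' = reported s \<and> i0 \<le> reg s' rI \<and>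
      (i0 < reg s' rI \<longrightarrow> reg s' rI \<le> cnt) \<and>
      (\<forall>a. a \<noteq> out \<longrightarrow> mem s' a = mem s a) \<and>
      (\<forall>i. i < i0 \<longrightarrow> mem s' out i = mem s out i) \<and>
      (\<forall>i. i0 \<le> i \<longrightarrow> i < reg s' rI \<longrightarrow> is_ext X Y m lm i (mem s' out i)) \<and>
      (\<forall>a. extent s' a \<le> (if a = 0 \<or> a = out then max (extent s a) m else extent s a)) \<and>
      reg s' rL \<le> reg s' rI \<and> (reg s' rI < reg s' rR \<longrightarrow> reg s' rR \<le> lm) \<and> reg s' rR \<le> reg s' rL + m \<and>
      (0 < reg s' rR \<longrightarrow> i0 \<le> reg s' rL \<and> reg s' rL < reg s' rI) \<and>
      (\<forall>t. reg s' rL + t < reg s' rR \<longrightarrow> X t = Y (reg s' rL + t)) \<and>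
      pc s' + 50 * i0 \<le> pc s + 2 + 50 * reg s' rI + 20 * reg s' rR" for s'
  have "wp w T (While Skip rI rCnt
       (guess;; match_loop f;; Op Add rU rI rK;; Cond rR rU (Move rL rI;; Move rR rU) Skip;;
        Store out rI rK;; Op Add rI rI rOne)) Q (set_reg rR 0 (set_reg rL 0 s))"
  proof (rule wp_while[where I = I and \<mu> = "\<lambda>s'. cnt - reg s' rI"], goal_cases)
    case 1
    show ?case by (simp add: I_def frame_def i0_def)
  next
    case (2 s1)
    let ?i = "reg s1 rI" and ?l = "reg s1 rL" and ?r = "reg s1 rR"
    note I = 2[unfolded I_def]
    have r: "reg s1 rZero = 0" "reg s1 rOne = 1" "reg s1 rM = m" "reg s1 rCnt = cnt"
      "reg s1 rLim = lm" "reg s1 rPx = reg s rPx" "reg s1 rPy = reg s rPy"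
      using I regs by (simp_all add: frame_def m_def cnt_def lm_def)
    show ?case
    proof (cases "?i < cnt")
      case False
      have "Q (tick 2 s1)"
      proof (rule Q, goal_cases)
        case 7
        \<comment> \<open>After at least one iteration \<open>?i \<le> m\<close> and
          \<open>?r \<le> 2 * m\<close>; otherwise the box is still empty and
          \<open>?r = 0\<close>.\<close>
        have "50 * ?i + 20 * ?r \<le> 50 * i0 + 90 * m"
          using I bounds by (cases "i0 < ?i") auto
        with I show ?case by auto
      qed (use I False in \<open>auto simp: frame_def\<close>)
      with False show ?thesis by (simp add: wp_simps r)
    next
      case True
      define init where "init = (if ?i < ?r then min (mem s1 0 (?i - ?l)) (?r - ?i) else 0)"
      \<comment> \<open>The last property says that a guess ending strictly inside the box is final:
        the mismatch recorded in the table is copied along with the box.\<close>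
      have k0: "init \<le> m" "init = 0 \<or> ?i + init \<le> lm" "\<forall>t<init. X t = Y (?i + t)"
        "?i < ?r \<Longrightarrow> init < ?r - ?i \<Longrightarrow> init < m \<and> ?i + init < lm \<and> X init \<noteq> Y (?i + init)"
      proof -
        \<comment> \<open>The entry was either written by this very loop, when the table is being
          built, or is provided by the hypothesis on the table.\<close>
        have z: "is_ext X X m m (?i - ?l) (mem s1 0 (?i - ?l))" if "?i < ?r"
        proof (cases "out = 0 \<and> i0 \<le> ?i - ?l")
          case True
          then show ?thesis using I that self by auto
        next
          case False
          have "1 \<le> ?i - ?l" "?i - ?l < m" using I that by auto
          moreover have "mem s1 0 (?i - ?l) = mem s 0 (?i - ?l)" using I False by (cases "out = 0") auto
          ultimately show ?thesis using False table by auto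
        qed
        have li: "?l < ?i" "?r - ?l \<le> m" "?r \<le> lm" if "?i < ?r" using I that by auto
        have box: "Y (?i + t) = X (?i - ?l + t)" if "?i < ?r" "t < ?r - ?i" for t
        proof -
          have "?l + (?i - ?l + t) < ?r" "?l + (?i - ?l + t) = ?i + t" using that li by auto
          with I show ?thesis by metis
        qed
        show "init \<le> m" using li by (auto simp: init_def)
        show "init = 0 \<or> ?i + init \<le> lm" using li by (auto simp: init_def)
        show "\<forall>t<init. X t = Y (?i + t)" using z box by (auto simp: is_ext_def init_def)
        assume i: "?i < ?r" "init < ?r - ?i"
        then have "init = mem s1 0 (?i - ?l)" by (auto simp: init_def)
        moreover have "init < m" "?i - ?l + init < m" using i li by auto
        ultimately have "X init \<noteq> X (?i - ?l + init)" using z[OF i(1)] by (auto simp: is_ext_def)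
        moreover have "init < m" "?i + init < lm" using i(2) li[OF i(1)] by linarith+
        ultimately show "init < m \<and> ?i + init < lm \<and> X init \<noteq> Y (?i + init)"
          using box[OF i] by simp
      qed
      have "wp w T (guess;; match_loop f;; Op Add rU rI rK;; Cond rR rU (Move rL rI;; Move rR rU) Skip;;
        Store out rI rK;; Op Add rI rI rOne) (\<lambda>s2. I (tick 1 s2) \<and> cnt - reg (tick 1 s2) rI < cnt - ?i) (tick 1 s1)"
        unfolding wp_Seq
      proof (rule wp_guess, goal_cases)
        case (4 s2)
        then have r2: "reg s2 rZero = 0" "reg s2 rOne = 1" "reg s2 rM = m" "reg s2 rCnt = cnt"
          "reg s2 rLim = lm" "reg s2 rPx = reg s rPx" "reg s2 rPy = reg s rPy"
          "reg s2 rI = ?i" "reg s2 rL = ?l" "reg s2 rR = ?r" "reg s2 rK = init"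
          by (simp_all add: frame_def r init_def)
        show ?case
        proof (rule wp_match_loop, goal_cases)
          case (6 s3)
          let ?k = "reg s3 rK"
          have r3: "reg s3 rZero = 0" "reg s3 rOne = 1" "reg s3 rM = m" "reg s3 rCnt = cnt"
            "reg s3 rI = ?i" "reg s3 rL = ?l" "reg s3 rR = ?r"
            using 6(1) by (simp_all add: frame_def r2)
          have XY: "chr w T f (reg s rPx) t = X t" "chr w T f (reg s rPy) t = Y t" for t
            by (simp_all add: X_def Y_def)
          note e = 6(3-8)[unfolded r2 XY]
          have agree: "X t = Y (?i + t)" if "t < ?k" for t
          proof (cases "t < init")
            case True
            with k0(3) show ?thesis by blast
          next
            case False
            then show ?thesis using e(4)[OF leI that] by blast
          qed
          have ext: "is_ext X Y m lm ?i ?k"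
            using e(2,3,5) k0(2) agree by (auto simp only: is_ext_def)
          txt \<open>If a comparison succeeds then the initial guess reached the right end of the Z-box, so
            every successful comparison moves that end.\<close>
          have amort: "20 * ?k + 20 * ?r \<le> 20 * init + 20 * max ?r (?i + ?k)"
          proof (cases "?k = init")
            case True
            then show ?thesis by (simp add: max_def)
          next
            case False
            with e(1) have "init < ?k" by linarith
            with agree have "X init = Y (?i + init)" by blast
            with k0(4) have "?i < ?r \<longrightarrow> \<not> init < ?r - ?i" by blast
            then have "?r \<le> ?i + init" by linarith
            then show ?thesis by (simp add: max_def)
          qed
          have small: "(?i + ?k) mod 2 ^ w = ?i + ?k" "Suc ?i mod 2 ^ w = Suc ?i"
            using e(2) True bounds by auto
          have len: "?i + ?k \<le> lm" if "0 < ?k"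
            using that e(3) k0(2) by auto
          have fr: "\<forall>q<14. reg s3 q = reg s q"
            using I 4(1) 6(1) by (simp add: frame_def)
          have mem: "mem s3 = mem s1" "reported s3 = reported s"
            using I 4 6(2) by (simp_all add: same_mem_def)
          have "?i < ?r \<Longrightarrow> Suc (?i - ?l) \<le> m"
            using I by auto
          then have ex: "\<forall>a. extent s3 a \<le> (if a = 0 \<or> a = out then max (extent s a) m else extent s a)"
            using I 4(5) 6(2) by (auto simp: same_mem_def le_max_iff_disj split: if_splits)
          have pcs: "pc s3 + 20 * ?r \<le> pc s1 + 31 + 20 * max ?r (?i + ?k)"
            using amort 4(6) e(6) by simp
          have ex': "Suc ?i \<le> m" using True bounds by simp
          have *: "I t \<and> cnt - reg t rI < cnt - ?i"
            if t: "frame rI s3 t" "reg t rI = Suc ?i"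
              "reg t rL = (if ?r < ?i + ?k then ?i else ?l)" "reg t rR = max ?r (?i + ?k)"
              "mem t = (mem s1)(out := (mem s1 out)(?i := ?k))"
              "extent t = (extent s3)(out := max (extent s3 out) (Suc ?i))"
              "reported t = reported s" "pc t \<le> pc s3 + 9" for t
          proof (intro conjI)
            show "cnt - reg t rI < cnt - ?i" using t(2) True by simp
            have 1: "frame rI s t" using fr t(1) by (simp add: frame_def)
            have 2: "\<forall>j. i0 \<le> j \<longrightarrow> j < reg t rI \<longrightarrow> is_ext X Y m lm j (mem t out j)"
              using I ext by (auto simp: t less_Suc_eq)
            have 3: "\<forall>a. extent t a \<le> (if a = 0 \<or> a = out then max (extent s a) m else extent s a)"
            proof
              fix a
              show "extent t a \<le> (if a = 0 \<or> a = out then max (extent s a) m else extent s a)"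
                using ex[rule_format, of a] ex' by (cases "a = out") (simp_all add: t le_max_iff_disj, linarith)
            qed
            have 4: "reg t rL \<le> reg t rI" "reg t rR \<le> reg t rL + m"
              "0 < reg t rR \<longrightarrow> i0 \<le> reg t rL \<and> reg t rL < reg t rI"
              using I e(2) by (auto simp: t)
            have 5: "reg t rI < reg t rR \<longrightarrow> reg t rR \<le> lm"
              using I len by (cases "?r < ?i + ?k") (auto simp: t max_def)
            have 6: "\<forall>j. reg t rL + j < reg t rR \<longrightarrow> X j = Y (reg t rL + j)"
            proof (cases "?r < ?i + ?k")
              case True
              then show ?thesis using agree by (simp add: t)
            next
              case False
              then show ?thesis using I by (simp add: t)
            qed
            have 7: "pc t + 50 * i0 \<le> pc s + 2 + 50 * reg t rI + 20 * reg t rR"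
              using pcs I t(8) by (simp add: t(2,4))
            show "I t"
              unfolding I_def using 1 2 3 4 5 6 7 I True by (simp add: t)
          qed
          \<comment> \<open>The two instances are the final states with a replaced box and with the
            old box.\<close>
          show ?case
            using *[of "tick 1 (set_reg rI (Suc ?i) (set_mem out ?i ?k (set_reg rR (?i + ?k)
                (set_reg rL ?i (tick 1 (set_reg rU (?i + ?k) s3))))))"]
              *[of "tick 1 (set_reg rI (Suc ?i) (set_mem out ?i ?k (tick 1 (tick 1 (set_reg rU (?i + ?k) s3)))))"]
              r3 mem
            by (simp add: wp_simps small frame_def max_def)
        qed (use regs bounds True r2 k0 in auto)
      qed (use I True bounds in auto)
      with True show ?thesis by (simp add: wp_simps r)
    qed
  qed
  then show ?thesis by (simp add: zloop_def wp_simps)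
qed

section \<open>Squares and runs\<close>

definition period_at :: "nat list \<Rightarrow> nat \<Rightarrow> nat \<Rightarrow> bool" where
  "period_at T p q \<longleftrightarrow> q + p < length T \<and> T ! q = T ! (q + p)"

lemma tandem_repeatsI:
  "T = x @ u @ u @ y \<Longrightarrow> u \<noteq> [] \<Longrightarrow> (length x, length u) \<in> tandem_repeats T"
  unfolding tandem_repeats_def by blast

lemma tandem_repeats_iff:
  "(i, p) \<in> tandem_repeats T \<longleftrightarrow> 0 < p \<and> (\<forall>t<p. period_at T p (i + t))"
proof
  assume "(i, p) \<in> tandem_repeats T"
  then obtain x u y where T: "u \<noteq> []" "T = x @ u @ u @ y" "i = length x" "p = length u"
    by (auto simp: tandem_repeats_def)
  have "period_at T p (i + t)" if "t < p" for t
  proof -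
    have "T ! (i + t) = u ! t" using that unfolding T(2-4) by (simp add: nth_append)
    moreover have "T ! (i + t + p) = u ! t" using that unfolding T(2-4) by (simp add: nth_append)
    moreover have "i + t + p < length T" using that unfolding T(2-4) by simp
    ultimately show ?thesis by (simp add: period_at_def)
  qed
  moreover have "0 < p" using T(1,4) by simp
  ultimately show "0 < p \<and> (\<forall>t<p. period_at T p (i + t))" by blast
next
  assume *: "0 < p \<and> (\<forall>t<p. period_at T p (i + t))"
  \<comment> \<open>The last position of the window shows that both halves of the square fit into
    the string.\<close>
  moreover have "p - 1 < p" using * by simp
  ultimately have "period_at T p (i + (p - 1))" by blast
  with conjunct1[OF *] have len: "i + 2 * p \<le> length T" by (auto simp: period_at_def)
  let ?u = "take p (drop i T)"
  have "?u = take p (drop (i + p) T)"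
  proof (rule nth_equalityI)
    show "length ?u = length (take p (drop (i + p) T))" using len by simp
    fix t assume "t < length ?u"
    with len have t: "t < p" by simp
    with * have "period_at T p (i + t)" by blast
    then have "T ! (i + t) = T ! (i + p + t)" by (simp add: period_at_def add_ac)
    with t len show "?u ! t = take p (drop (i + p) T) ! t" by simp
  qed
  then have 1: "drop (i + p) T = ?u @ drop (i + p + p) T"
    by (metis append_take_drop_id drop_drop add.commute)
  have 2: "drop i T = ?u @ drop (i + p) T"
    by (metis append_take_drop_id drop_drop add.commute)
  have "take i T @ ?u @ ?u @ drop (i + p + p) T = take i T @ drop i T"
    by (simp only: 1[symmetric] 2[symmetric])
  also have "\<dots> = T" by simp
  finally have T: "T = take i T @ ?u @ ?u @ drop (i + p + p) T" by (rule sym)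
  have l: "length (take i T) = i" "length ?u = p" "?u \<noteq> []" using len * by auto
  show "(i, p) \<in> tandem_repeats T"
    using tandem_repeatsI[OF T l(3)] by (simp only: l)
qed

section \<open>Runs of good positions relative to a block\<close>

definition left_run :: "nat list \<Rightarrow> nat \<Rightarrow> nat \<Rightarrow> nat \<Rightarrow> bool" where
  "left_run T p a R \<longleftrightarrow> R \<le> a \<and> (\<forall>q. a - R \<le> q \<longrightarrow> q < a \<longrightarrow> period_at T p q) \<and>
     (R < a \<longrightarrow> \<not> period_at T p (a - R - 1))"

text \<open>The length is capped at the block length: \<open>f = m\<close> means that the block has
  no bad position, while for \<open>f < m\<close> the first one is \<open>a + f\<close>.\<close>

definition right_run :: "nat list \<Rightarrow> nat \<Rightarrow> nat \<Rightarrow> nat \<Rightarrow> nat \<Rightarrow> bool" where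
  "right_run T p a m f \<longleftrightarrow> f \<le> m \<and> (\<forall>q. a \<le> q \<longrightarrow> q < a + f \<longrightarrow> period_at T p q) \<and>
     (f < m \<longrightarrow> \<not> period_at T p (a + f))"

text \<open>For the starting position \<open>i\<close> of a square this says that the run containing
  the square stops before \<open>a\<close>.\<close>

definition ended :: "nat list \<Rightarrow> nat \<Rightarrow> nat \<Rightarrow> nat \<Rightarrow> bool" where
  "ended T p a i \<longleftrightarrow> (\<exists>q. i \<le> q \<and> q < a \<and> \<not> period_at T p q)"

text \<open>The squares to report after a block are those whose run ends in it. The first bad
  position of the block is \<open>a + f\<close>, so they are the windows of length \<open>p\<close>
  inside the run from \<open>a - R\<close> to \<open>a + f\<close> (exclusive).\<close>

lemma squares_of_run:
  assumes R: "left_run T p a R" and F: "right_run T p a m f" and p: "0 < p" "m \<le> p"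
  shows "(i, p) \<in> tandem_repeats T \<and> ended T p (a + m) i \<and> \<not> ended T p a i \<longleftrightarrow>
    f < m \<and> a - R \<le> i \<and> i + p \<le> a + f"
proof
  assume l: "(i, p) \<in> tandem_repeats T \<and> ended T p (a + m) i \<and> \<not> ended T p a i"
  then have sq: "\<And>t. t < p \<Longrightarrow> period_at T p (i + t)" by (simp add: tandem_repeats_iff)
  from l obtain q where q: "i \<le> q" "q < a + m" "\<not> period_at T p q" by (auto simp: ended_def)
  \<comment> \<open>A bad position from \<open>i\<close> on cannot lie in the window of the
    square.\<close>
  have "i + p \<le> q" using sq[of "q - i"] q by (cases "q - i < p") auto
  have "a \<le> q" using l q by (meson ended_def not_le)
  then have "f \<le> q - a" using F q by (cases "q - a < f") (auto simp: right_run_def)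
  then have "f < m" using \<open>a \<le> q\<close> q by linarith
  then have "\<not> period_at T p (a + f)" using F by (simp add: right_run_def)
  \<comment> \<open>Here \<open>m \<le> p\<close> enters: a square that begins inside the block
    cannot be followed by a bad position of the same block.\<close>
  moreover have "i \<le> a" using \<open>i + p \<le> q\<close> q p by linarith
  ultimately have "i + p \<le> a + f" using sq[of "a + f - i"] by (cases "a + f - i < p") auto
  moreover have "a - R \<le> i"
  proof (rule ccontr)
    assume "\<not> a - R \<le> i"
    then have "i \<le> a - R - 1" "a - R - 1 < a" "R < a" by auto
    with R l show False by (auto simp: left_run_def ended_def)
  qed
  ultimately show "f < m \<and> a - R \<le> i \<and> i + p \<le> a + f" using \<open>f < m\<close> by blast
next
  assume r: "f < m \<and> a - R \<le> i \<and> i + p \<le> a + f"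
  have run: "period_at T p q" if "a - R \<le> q" "q < a + f" for q
    using that R F by (cases "q < a") (auto simp: left_run_def right_run_def)
  have "(i, p) \<in> tandem_repeats T"
    using run r p by (auto simp: tandem_repeats_iff)
  moreover have "ended T p (a + m) i"
    unfolding ended_def using r F by (intro exI[of _ "a + f"]) (auto simp: right_run_def)
  moreover have "\<not> ended T p a i" using run r by (auto simp: ended_def)
  ultimately show "(i, p) \<in> tandem_repeats T \<and> ended T p (a + m) i \<and> \<not> ended T p a i" by blast
qed

lemma ended_mono: "ended T p a i \<Longrightarrow> a \<le> b \<Longrightarrow> ended T p b i"
  by (auto simp: ended_def)

lemma left_run_0: "left_run T p 0 0"
  by (simp add: left_run_def)

lemma left_run_extend:
  assumes "left_run T p a R" "right_run T p a m m"
  shows "left_run T p (a + m) (R + m)"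
  unfolding left_run_def
proof (intro conjI allI impI)
  fix q assume "a + m - (R + m) \<le> q" "q < a + m"
  then show "period_at T p q" using assms by (cases "q < a") (auto simp: left_run_def right_run_def)
qed (use assms in \<open>auto simp: left_run_def right_run_def\<close>)

section \<open>Runs as longest common extensions\<close>

lemma is_extD:
  assumes "is_ext X Y m lm i k"
  shows "k \<le> m" "k = 0 \<or> i + k \<le> lm" "t < k \<Longrightarrow> X t = Y (i + t)"
    "k < m \<Longrightarrow> i + k < lm \<Longrightarrow> X k \<noteq> Y (i + k)"
  using assms by (auto simp: is_ext_def)

text \<open>The block is compared with the text that starts \<open>lo\<close> positions further
  right; shift \<open>j\<close> in that text pairs each position with its partner at distance
  \<open>lo + j\<close>.\<close>

lemma right_run_is_ext:
  assumes ext: "is_ext (chr w T Add a) (chr w T Add (a + lo)) m (length T - (a + lo)) j f"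
    and n: "length T < 2 ^ w" "a + lo \<le> length T" "m \<le> lo"
  shows "right_run T (lo + j) a m f"
proof -
  have X: "chr w T Add a t = T ! (a + t)" if "a + t < length T" for t
    using that n by (simp add: inp_def)
  have Y: "chr w T Add (a + lo) u = T ! (a + lo + u)" if "a + lo + u < length T" for u
    using that n by (simp add: inp_def)
  show ?thesis
    unfolding right_run_def
  proof (intro conjI allI impI)
    show "f \<le> m" using ext by (simp add: is_ext_def)
  next
    fix q assume q: "a \<le> q" "q < a + f"
    then have "j + f \<le> length T - (a + lo)" using is_extD(2)[OF ext] by auto
    then have "q + (lo + j) < length T" using q n by linarith
    moreover have "chr w T Add a (q - a) = chr w T Add (a + lo) (j + (q - a))"
      using is_extD(3)[OF ext, of "q - a"] q by linarith
    moreover have "a + (q - a) = q" "a + lo + (j + (q - a)) = q + (lo + j)" using q by auto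
    ultimately show "period_at T (lo + j) q"
      using X[of "q - a"] Y[of "j + (q - a)"] by (simp add: period_at_def add_ac)
  next
    assume f: "f < m"
    show "\<not> period_at T (lo + j) (a + f)"
    \<comment> \<open>If the extension was stopped by the end of the string, position
      \<open>a + f\<close> has no partner and is bad.\<close>
    proof (cases "j + f < length T - (a + lo)")
      case True
      moreover have "chr w T Add a f \<noteq> chr w T Add (a + lo) (j + f)"
        using is_extD(4)[OF ext f True] .
      moreover have "a + lo + (j + f) = a + f + (lo + j)" by simp
      ultimately show ?thesis using X[of f] Y[of "j + f"] by (simp add: period_at_def add_ac)
    qed (auto simp: period_at_def)
  qed
qed

text \<open>Both strings are read from right to left, which reverses the order of the periods: shift
  \<open>cnt - 1 - j\<close> belongs to period \<open>lo + j\<close>. The window of length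
  \<open>m + cnt\<close> is long enough never to cut an extension short.\<close>

lemma left_run_is_ext:
  assumes ext: "is_ext (chr w T Sub (a + m - 1)) (chr w T Sub (a + m - 1 + lo + cnt - 1)) m (m + cnt)
      (cnt - 1 - j) g"
    and n: "length T < 2 ^ w" "a + m + lo + cnt \<le> length T + 1" "m \<le> lo" "cnt \<le> m" "j < cnt"
    and f: "right_run T (lo + j) a m f" "f < m"
  shows "left_run T (lo + j) (a + m) g"
proof -
  have X: "chr w T Sub (a + m - 1) t = T ! (a + m - 1 - t)" if "t < m" for t
    using that n sub_mod[of t "a + m - 1" w] by (auto simp: inp_def simp del: One_nat_def)
  have Y: "chr w T Sub (a + m - 1 + lo + cnt - 1) (cnt - 1 - j + t) = T ! (a + m - 1 - t + (lo + j))"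
    if "t < m" for t
  proof -
    have *: "cnt - 1 - j + t \<le> a + m - 1 + lo + cnt - 1" "a + m - 1 + lo + cnt - 1 < 2 ^ w"
      "a + m - 1 + lo + cnt - 1 - (cnt - 1 - j + t) = a + m - 1 - t + (lo + j)"
      "a + m - 1 - t + (lo + j) < length T" using that n by auto
    show ?thesis
      by (simp only: eval_op.simps inp_def sub_mod[OF *(1,2)] *(3,4) if_True)
  qed
  have g: "g \<le> m" "\<And>t. t < g \<Longrightarrow> T ! (a + m - 1 - t) = T ! (a + m - 1 - t + (lo + j))"
    "g < m \<Longrightarrow> T ! (a + m - 1 - g) \<noteq> T ! (a + m - 1 - g + (lo + j))"
  proof -
    show 1: "g \<le> m" using ext by (simp add: is_ext_def)
    show "T ! (a + m - 1 - t) = T ! (a + m - 1 - t + (lo + j))" if "t < g" for t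
      using is_extD(3)[OF ext that] that 1 X[of t] Y[of t] by linarith
    show "T ! (a + m - 1 - g) \<noteq> T ! (a + m - 1 - g + (lo + j))" if "g < m"
      using is_extD(4)[OF ext that] that X[of g] Y[of g] n by auto
  qed
  have m: "period_at T (lo + j) q" if "a + m - g \<le> q" "q < a + m" for q
    using that g(1) g(2)[of "a + m - 1 - q"] n by (auto simp: period_at_def)
  \<comment> \<open>The block contains the bad position \<open>a + f\<close>, so the backward
    extension stops inside the block and does not merely reach the cap \<open>m\<close>.\<close>
  have "g < m"
  proof (rule ccontr)
    assume "\<not> g < m"
    then have "period_at T (lo + j) (a + f)" using m[of "a + f"] f(2) by simp
    with f show False by (simp add: right_run_def)
  qed
  then have "\<not> period_at T (lo + j) (a + m - g - 1)" using g(3) by (simp add: period_at_def diff_right_commute)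
  with m \<open>g < m\<close> show ?thesis by (simp add: left_run_def)
qed

text \<open>The position just before \<open>a\<close> has its partner beyond the end of the
  string.\<close>

lemma left_run_beyond: "length T < a + p \<Longrightarrow> left_run T p a 0"
  by (auto simp: left_run_def period_at_def)

section \<open>The program\<close>

definition ext_le :: "nat \<Rightarrow> config \<Rightarrow> bool" where
  "ext_le S s \<longleftrightarrow> (\<forall>a<4. extent s a \<le> S) \<and> (\<forall>a\<ge>4. extent s a = 0)"

lemma ext_le_simps [simp]:
  "ext_le S (set_reg r v s) = ext_le S s" "ext_le S (tick k s) = ext_le S s"
  "ext_le S s \<Longrightarrow> i < S \<Longrightarrow> a < 4 \<Longrightarrow> ext_le S (touch a i s)"
  "ext_le S s \<Longrightarrow> i < S \<Longrightarrow> a < 4 \<Longrightarrow> ext_le S (set_mem a i v s)"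
  by (auto simp: ext_le_def)

text \<open>\<open>rV\<close> starts at one more than the run length, so the loop reports (run
  length) + 1 - (period) squares, and none if the run is too short; no negative difference
  arises.\<close>

definition report_run :: com where
  "report_run = While Skip rK rV (Report rU rK;; Op Add rU rU rOne;; Op Sub rV rV rOne)"

lemma wp_report_run:
  assumes regs: "reg s rOne = 1" "0 < reg s rK" "reg s rV < 2 ^ w" "reg s rU + (reg s rV - reg s rK) < 2 ^ w"
    and Q: "\<And>s'. frame rK s s' \<Longrightarrow> mem s' = mem s \<Longrightarrow> extent s' = extent s \<Longrightarrow>
      reported s' = reported s @
        map (\<lambda>i. (i, reg s rK)) [reg s rU..<reg s rU + (reg s rV - reg s rK)] \<Longrightarrow>
      pc s' \<le> pc s + 2 + 5 * (reg s rV - reg s rK) \<Longrightarrow> Q s'"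
  shows "wp w T report_run Q s"
proof -
  let ?q = "reg s rU" and ?p = "reg s rK" and ?u = "reg s rV"
  define I where "I s' \<longleftrightarrow> frame rU s s' \<and> mem s' = mem s \<and> extent s' = extent s \<and>
    ?q \<le> reg s' rU \<and> reg s' rU - ?q \<le> ?u - ?p \<and> reg s' rV = ?u - (reg s' rU - ?q) \<and>
    reported s' = reported s @ map (\<lambda>i. (i, ?p)) [?q..<reg s' rU] \<and>
    pc s' \<le> pc s + 5 * (reg s' rU - ?q)" for s'
  show ?thesis
    unfolding report_run_def
  proof (rule wp_while[where I = I and \<mu> = "\<lambda>s'. reg s' rV"], goal_cases)
    case 1
    show ?case by (simp add: I_def)
  next
    case (2 t)
    note I = 2[unfolded I_def]
    have r: "reg t rOne = 1" "reg t rK = ?p" using I regs by (simp_all add: frame_def)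
    show ?case
    proof (cases "?p < reg t rV")
      case True
      have "Suc (reg t rU) mod 2 ^ w = Suc (reg t rU)" using True I regs by simp
      moreover have "(reg t rV + 2 ^ w - 1) mod 2 ^ w = reg t rV - 1"
        using True I regs by (intro sub_mod) auto
      ultimately show ?thesis
        using True I regs r
        by (simp add: wp_simps I_def frame_def Suc_diff_le) linarith
    next
      case False
      then have "reg t rU = ?q + (?u - ?p)" using I by linarith
      then have "Q (tick 2 t)"
        using I frame_mono[of rU s t rK] by (intro Q) (simp_all add: frame_def)
      with False show ?thesis by (simp add: wp_simps r)
    qed
  qed
qed

definition report :: com where
  "report = (Move rI rZero;;
     While Skip rI rM
       (Load rL 1 rI;;
        Cond rL rM
          (Load rR 3 rI;; Op Add rK rLo rI;; Op Sub rU rA rR;; Op Add rV rR rL;;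
           Op Add rV rV rOne;; report_run)
          Skip;;
        Op Add rI rI rOne))"

text \<open>The squares that are known once the batch starting at \<open>lo\<close> has processed the positions below \<open>a\<close>:
  a square is reported when the run containing it has ended.\<close>

definition found :: "nat list \<Rightarrow> nat \<Rightarrow> nat \<Rightarrow> nat \<Rightarrow> (nat \<times> nat) set" where
  "found T lo m a =
     {(i, p) \<in> tandem_repeats T. p < lo \<or> p < lo + m \<and> ended T p a i}"

text \<open>Each period costs at most 20 steps and each report 5; the latter are paid for by the
  growth of the output, which is how \<open>occ\<close> enters the running time.\<close>

lemma wp_report:
  fixes s
  defines "m \<equiv> reg s rM" and "lo \<equiv> reg s rLo" and "a \<equiv> reg s rA"
  assumes regs: "reg s rZero = 0" "reg s rOne = 1"
    and bounds: "length T < 2 ^ w" "0 < m" "m \<le> lo" "lo + m \<le> length T" "a + lo \<le> length T" "m \<le> S"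
    and F: "\<And>j. j < m \<Longrightarrow> right_run T (lo + j) a m (mem s 1 j)"
    and R: "\<And>j. j < m \<Longrightarrow> left_run T (lo + j) a (mem s 3 j)"
    and ext: "ext_le S s"
    and rep: "distinct (reported s)" "set (reported s) = found T lo m a"
    and Q: "\<And>s'. frame rI s s' \<Longrightarrow> mem s' = mem s \<Longrightarrow> ext_le S s' \<Longrightarrow> distinct (reported s') \<Longrightarrow>
      set (reported s') = found T lo m (a + m) \<Longrightarrow>
      pc s' + 5 * length (reported s) \<le> pc s + 3 + 20 * m + 5 * length (reported s') \<Longrightarrow> Q s'"
  shows "wp w T report Q s"
proof -
  \<comment> \<open>Interpolates between the two values of \<open>found\<close>: the periods below
    \<open>lo + j\<close> have been advanced to \<open>a + m\<close>, the others are still at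
    \<open>a\<close>.\<close>
  define found' where "found' j = {(i, p) \<in> tandem_repeats T. p < lo \<or>
    p < lo + m \<and> ended T p (if p < lo + j then a + m else a) i}" for j
  define I where "I s' \<longleftrightarrow> frame rI s s' \<and> mem s' = mem s \<and> ext_le S s' \<and> reg s' rI \<le> m \<and>
    distinct (reported s') \<and> set (reported s') = found' (reg s' rI) \<and>
    pc s' + 5 * length (reported s) \<le> pc s + 1 + 20 * reg s' rI + 5 * length (reported s')" for s'
  have found'_m: "found' m = found T lo m (a + m)" by (auto simp: found'_def found_def)
  have found'_0: "found' 0 = found T lo m a" by (auto simp: found'_def found_def)
  have found'_Suc: "found' (Suc j) = found' j \<union> {(i, p). p = lo + j \<and> (i, p) \<in> tandem_repeats T \<and>
      ended T p (a + m) i \<and> \<not> ended T p a i}" if "j < m" for j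
    using that ended_mono[of T "lo + j" a _ "a + m"]
    by (auto simp: found'_def less_Suc_eq split: if_splits)
  have "wp w T (While Skip rI rM
       (Load rL 1 rI;;
        Cond rL rM
          (Load rR 3 rI;; Op Add rK rLo rI;; Op Sub rU rA rR;; Op Add rV rR rL;;
           Op Add rV rV rOne;; report_run)
          Skip;;
        Op Add rI rI rOne)) Q (set_reg rI 0 s)"
  proof (rule wp_while[where I = I and \<mu> = "\<lambda>s'. m - reg s' rI"], goal_cases)
    case 1
    show ?case using ext rep by (simp add: I_def frame_def found'_0)
  next
    case (2 t)
    note I = 2[unfolded I_def]
    let ?j = "reg t rI"
    have r: "reg t rOne = 1" "reg t rM = m" "reg t rLo = lo" "reg t rA = a"
      using I regs by (simp_all add: frame_def m_def lo_def a_def)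
    show ?case
    proof (cases "?j < m")
      case j: True
      let ?f = "mem s 1 ?j" and ?R = "mem s 3 ?j" and ?p = "lo + ?j"
      have new: "found' (Suc ?j) = found' ?j \<union> {(i, p). p = ?p \<and> ?f < m \<and> a - ?R \<le> i \<and> i + ?p \<le> a + ?f}"
        unfolding found'_Suc[OF j]
        using squares_of_run[OF R[OF j] F[OF j]] bounds by auto
      \<comment> \<open>The runs in question had not ended at \<open>a\<close>, so none of these
        squares was reported before; this keeps the output distinct.\<close>
      have disj: "found' ?j \<inter> {(i, p). p = ?p \<and> ?f < m \<and> a - ?R \<le> i \<and> i + ?p \<le> a + ?f} = {}"
        using squares_of_run[OF R[OF j] F[OF j]] bounds by (auto simp: found'_def)
      have Suc_j: "Suc ?j mod 2 ^ w = Suc ?j" using j bounds by simp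
      show ?thesis
      proof (cases "?f < m")
        case True
        \<comment> \<open>Together with the next fact this bounds the run length by
          \<open>length T\<close>, so no word operation wraps around.\<close>
        have Ra: "?R \<le> a" using R[OF j] by (simp add: left_run_def)
        have fn: "a + ?f < length T"
        proof (cases "?f = 0")
          case True
          with bounds show ?thesis by simp
        next
          case False
          then have "period_at T ?p (a + ?f - 1)" using F[OF j] by (simp add: right_run_def)
          then have "a + ?f - 1 + ?p < length T" by (simp add: period_at_def)
          with False bounds show ?thesis by linarith
        qed
        have small: "?p mod 2 ^ w = ?p" "(a + 2 ^ w - ?R) mod 2 ^ w = a - ?R"
          "(?R + ?f) mod 2 ^ w = ?R + ?f" "Suc (?R + ?f) mod 2 ^ w = Suc (?R + ?f)"
          using Ra fn bounds j by (auto intro!: sub_mod)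
        \<comment> \<open>Truncated subtraction makes the interval empty when the run is shorter
          than the period.\<close>
        let ?new = "{a - ?R..<a - ?R + (Suc (?R + ?f) - ?p)}"
        have run: "(\<lambda>i. (i, ?p)) ` ?new = {(i, p). p = ?p \<and> ?f < m \<and> a - ?R \<le> i \<and> i + ?p \<le> a + ?f}"
          using True Ra by auto
        have new': "found' (Suc ?j) = found' ?j \<union> (\<lambda>i. (i, ?p)) ` ?new"
          unfolding new run ..
        have disj': "found' ?j \<inter> (\<lambda>i. (i, ?p)) ` ?new = {}"
          unfolding run by (rule disj)
        have "mem t = mem s" using I by simp
        then show ?thesis
          using j True small
          apply (simp add: wp_simps r)
        proof (rule wp_report_run, goal_cases)
          case (5 s')
          have "length (reported s') = length (reported t) + (Suc (?R + ?f) - ?p)"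
            using 5 by simp
          moreover have "ext_le S s'"
            using 5 I j bounds by (simp add: ext_le_def split: if_splits)
          ultimately show ?case
            using 5 j I Suc_j r new' disj'
            by (simp add: wp_simps I_def frame_def distinct_map inj_on_def)
        qed (use regs bounds fn small Ra r in simp_all)
      next
        case False
        then have "found' (Suc ?j) = found' ?j" using new by simp
        with I j False Suc_j bounds show ?thesis
          by (simp add: wp_simps I_def r frame_def)
      qed
    next
      case False
      with I have "Q (tick 2 t)" by (intro Q) (auto simp: frame_def found'_m)
      with False show ?thesis by (simp add: wp_simps r)
    qed
  qed
  then show ?thesis using regs by (simp add: report_def wp_simps)
qed

definition clear :: com where
  "clear = (Move rI rZero;; While Skip rI rM (Store 3 rI rZero;; Op Add rI rI rOne))"

lemma wp_clear:
  fixes s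
  defines "m \<equiv> reg s rM"
  assumes regs: "reg s rZero = 0" "reg s rOne = 1" "m < 2 ^ w" "m \<le> S" "ext_le S s"
    and Q: "\<And>s'. frame rI s s' \<Longrightarrow> (\<And>j. j < m \<Longrightarrow> mem s' 3 j = 0) \<Longrightarrow> ext_le S s' \<Longrightarrow>
      reported s' = reported s \<Longrightarrow> pc s' \<le> pc s + 3 + 4 * m \<Longrightarrow> Q s'"
  shows "wp w T clear Q s"
proof -
  define I where "I s' \<longleftrightarrow> frame rI s s' \<and> ext_le S s' \<and> reg s' rI \<le> m \<and>
    (\<forall>j<reg s' rI. mem s' 3 j = 0) \<and> reported s' = reported s \<and> pc s' \<le> pc s + 1 + 4 * reg s' rI" for s'
  have "wp w T (While Skip rI rM (Store 3 rI rZero;; Op Add rI rI rOne)) Q (set_reg rI 0 s)"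
  proof (rule wp_while[where I = I and \<mu> = "\<lambda>s'. m - reg s' rI"], goal_cases)
    case 1
    show ?case using regs by (simp add: I_def frame_def)
  next
    case (2 t)
    note I = 2[unfolded I_def]
    have r: "reg t rOne = 1" "reg t rM = m" "reg t rZero = 0"
      using I regs by (simp_all add: frame_def m_def)
    show ?case
    proof (cases "reg t rI < m")
      case True
      then have "Suc (reg t rI) mod 2 ^ w = Suc (reg t rI)" using regs by simp
      with True I r regs(4) show ?thesis
        by (auto simp: wp_simps I_def frame_def less_Suc_eq)
    next
      case False
      with I have "Q (tick 2 t)" by (intro Q) (auto simp: frame_def)
      with False show ?thesis by (simp add: wp_simps r)
    qed
  qed
  then show ?thesis using regs by (simp add: clear_def wp_simps)
qed

text \<open>A block without bad positions lengthens the run by \<open>m\<close>. Otherwise the run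
  restarts with the backward extension, stored at the reversed index, or with 0 for periods from
  \<open>lo + cnt\<close> on.\<close>

definition update :: com where
  "update = (Move rI rZero;;
     While Skip rI rM
       (Load rL 1 rI;;
        Cond rL rM
          (Move rK rZero;;
           Cond rI rCnt (Op Sub rU rCnt rI;; Op Sub rU rU rOne;; Load rK 2 rU) Skip)
          (Load rK 3 rI;; Op Add rK rK rM);;
        Store 3 rI rK;; Op Add rI rI rOne))"

lemma wp_update:
  fixes s
  defines "m \<equiv> reg s rM" and "cnt \<equiv> reg s rCnt"
  assumes regs: "reg s rZero = 0" "reg s rOne = 1" "m < 2 ^ w" "m \<le> S" "ext_le S s" "cnt \<le> m"
    and small: "\<And>j. j < m \<Longrightarrow> mem s 1 j \<ge> m \<Longrightarrow> mem s 3 j + m < 2 ^ w"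
    and Q: "\<And>s'. frame rI s s' \<Longrightarrow>
      (\<And>j. j < m \<Longrightarrow> mem s' 3 j = (if mem s 1 j < m then if j < cnt then mem s 2 (cnt - 1 - j) else 0
        else mem s 3 j + m)) \<Longrightarrow> ext_le S s' \<Longrightarrow>
      reported s' = reported s \<Longrightarrow> pc s' \<le> pc s + 3 + 15 * m \<Longrightarrow> Q s'"
  shows "wp w T update Q s"
proof -
  define I where "I s' \<longleftrightarrow> frame rI s s' \<and> ext_le S s' \<and> reg s' rI \<le> m \<and>
    (\<forall>a. a \<noteq> 3 \<longrightarrow> mem s' a = mem s a) \<and> (\<forall>j. reg s' rI \<le> j \<longrightarrow> mem s' 3 j = mem s 3 j) \<and>
    (\<forall>j<reg s' rI. mem s' 3 j = (if mem s 1 j < m then if j < cnt then mem s 2 (cnt - 1 - j) else 0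
        else mem s 3 j + m)) \<and>
    reported s' = reported s \<and> pc s' \<le> pc s + 1 + 15 * reg s' rI" for s'
  have "wp w T (While Skip rI rM
       (Load rL 1 rI;;
        Cond rL rM
          (Move rK rZero;;
           Cond rI rCnt (Op Sub rU rCnt rI;; Op Sub rU rU rOne;; Load rK 2 rU) Skip)
          (Load rK 3 rI;; Op Add rK rK rM);;
        Store 3 rI rK;; Op Add rI rI rOne)) Q (set_reg rI 0 s)"
  proof (rule wp_while[where I = I and \<mu> = "\<lambda>s'. m - reg s' rI"], goal_cases)
    case 1
    show ?case using regs by (simp add: I_def frame_def)
  next
    case (2 t)
    note I = 2[unfolded I_def]
    let ?j = "reg t rI"
    have r: "reg t rOne = 1" "reg t rM = m" "reg t rZero = 0" "reg t rCnt = cnt"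
      using I regs by (simp_all add: frame_def m_def cnt_def)
    show ?case
    proof (cases "?j < m")
      case j: True
      have Suc_j: "Suc ?j mod 2 ^ w = Suc ?j" using j regs by simp
      have sub: "(cnt + 2 ^ w - ?j) mod 2 ^ w = cnt - ?j"
        "(cnt - ?j + 2 ^ w - 1) mod 2 ^ w = cnt - 1 - ?j" if "?j < cnt"
        using that regs sub_mod[of ?j cnt w] sub_mod[of 1 "cnt - ?j" w] by auto
      have add: "(mem s 3 ?j + m) mod 2 ^ w = mem s 3 ?j + m" if "\<not> mem s 1 ?j < m"
        using that small[OF j] by simp
      show ?thesis
        using j I r Suc_j sub add regs(4,6)
        by (cases "mem s 1 ?j < m"; cases "?j < cnt")
          (simp_all add: wp_simps I_def frame_def less_Suc_eq)
    next
      case False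
      with I have "Q (tick 2 t)" by (intro Q) (auto simp: frame_def)
      with False show ?thesis by (simp add: wp_simps r)
    qed
  qed
  then show ?thesis using regs by (simp add: update_def wp_simps)
qed

section \<open>Processing of one block\<close>

definition ctx :: "nat list \<Rightarrow> nat \<Rightarrow> nat \<Rightarrow> nat \<Rightarrow> config \<Rightarrow> bool" where
  "ctx T lo m a s \<longleftrightarrow> reg s rN = length T \<and> reg s rZero = 0 \<and> reg s rOne = 1 \<and> reg s rLo = lo \<and>
     reg s rM = m \<and> reg s rE = length T - lo + 1 \<and> reg s rA = a"

lemma ctx_frame: "frame 10 s s' \<Longrightarrow> ctx T lo m a s' = ctx T lo m a s"
  by (simp add: frame_def ctx_def)

lemma ext_le_max:
  assumes "ext_le S s" "\<And>a. extent t a \<le> (if a = 0 \<or> a = out then max (extent s a) m else extent s a)"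
    "m \<le> S" "out < 4"
  shows "ext_le S t"
  unfolding ext_le_def
proof (intro conjI allI impI)
  fix a :: nat
  show "extent t a \<le> S" if "a < 4"
    using assms(1) assms(2)[of a] assms(3) that unfolding ext_le_def
    by (auto split: if_splits intro: order_trans)
  show "extent t a = 0" if "4 \<le> a"
    using assms(1) assms(2)[of a] assms(4) that unfolding ext_le_def by auto
qed

text \<open>The first pass builds the Z-table of the block, the second matches the block against the
  text at distance \<open>lo\<close>, stopping at the end of the string.\<close>

definition forward :: com where
  "forward = (Move rPx rA;; Move rPy rA;; Move rCnt rM;; Move rLim rM;; Move rI rOne;; zloop Add 0;;
     Op Add rPy rA rLo;; Op Sub rLim rN rPy;; Move rI rZero;; zloop Add 1)"

lemma wp_forward:
  assumes ctx: "ctx T lo m a s"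
    and bounds: "length T < 2 ^ w" "0 < m" "m \<le> lo" "lo + m \<le> length T" "a + lo \<le> length T" "m \<le> S"
    and ext: "ext_le S s"
    and Q: "\<And>s'. frame 10 s s' \<Longrightarrow> mem s' 3 = mem s 3 \<Longrightarrow>
      (\<And>j. j < m \<Longrightarrow> right_run T (lo + j) a m (mem s' 1 j)) \<Longrightarrow> ext_le S s' \<Longrightarrow>
      reported s' = reported s \<Longrightarrow> pc s' \<le> pc s + 16 + 200 * m \<Longrightarrow> Q s'"
  shows "wp w T forward Q s"
proof -
  have w: "0 < w" using bounds by (cases w) auto
  note r = ctx[unfolded ctx_def]
  have sum: "(a + lo) mod 2 ^ w = a + lo" using bounds by simp
  have sub: "(length T + 2 ^ w - (a + lo)) mod 2 ^ w = length T - (a + lo)"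
    using bounds by (intro sub_mod) auto
  show ?thesis
    unfolding forward_def
    apply (simp add: wp_simps r)
  proof (rule wp_zloop, goal_cases)
    case (9 s1)
    have r1: "reg s1 rN = length T" "reg s1 rZero = 0" "reg s1 rOne = 1" "reg s1 rLo = lo"
      "reg s1 rM = m" "reg s1 rA = a" "reg s1 rPx = a" "reg s1 rCnt = m" and f: "frame 10 s s1"
      using 9(1) r by (simp_all add: frame_def)
    have mem1: "mem s1 3 = mem s 3" and rep1: "reported s1 = reported s"
      and pc1: "pc s1 \<le> pc s + 9 + 100 * m"
      using 9(2) 9(3)[of 3] 9(7) r by simp_all
    have table: "is_ext (chr w T Add a) (chr w T Add a) m m k (mem s1 0 k)" if "1 \<le> k" "k < m" for k
      using 9(5)[of k] that r by simp
    have ext1: "ext_le S s1"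
      by (rule ext_le_max[OF _ 9(6)]) (use bounds ext r in simp_all)
    show ?case
      apply (simp add: wp_simps r1 sum sub)
    proof (rule wp_zloop, goal_cases)
      case (9 s2)
      show ?case
      proof (rule Q)
        show "frame 10 s s2" using f 9(1) by (simp add: frame_def)
        show "mem s2 3 = mem s 3" using 9(3)[of 3] mem1 by simp
        show "right_run T (lo + j) a m (mem s2 1 j)" if "j < m" for j
          using 9(5)[of j] that bounds
          by (intro right_run_is_ext[where w = w]) (simp_all add: r1)
        show "ext_le S s2"
          by (rule ext_le_max[OF _ 9(6)]) (use bounds ext1 r1 in simp_all)
        show "reported s2 = reported s" using 9(2) rep1 by simp
        show "pc s2 \<le> pc s + 16 + 200 * m" using 9(7) pc1 by (simp add: r1)
      qed
    qed (use w bounds table r1 in auto)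
  qed (use w bounds r in auto)
qed

text \<open>The mirror image of the forward pass, anchored at the last position of the block. The
  second pass is restricted to \<open>rCnt\<close> periods so that no address exceeds the
  string.\<close>

definition backward :: com where
  "backward = (Op Add rPx rA rM;; Op Sub rPx rPx rOne;; Move rPy rPx;; Move rCnt rM;; Move rLim rM;;
     Move rI rOne;; zloop Sub 0;;
     Op Sub rI rE rA;; Op Sub rCnt rI rM;; Cond rM rCnt (Move rCnt rM) Skip;; Op Add rLim rM rCnt;;
     Op Add rPy rPx rLo;; Op Add rPy rPy rCnt;; Op Sub rPy rPy rOne;; Move rI rZero;; zloop Sub 2;;
     update;; Op Add rA rA rM)"

lemma wp_backward:
  assumes ctx: "ctx T lo m a s"
    and bounds: "length T < 2 ^ w" "0 < m" "m \<le> lo" "lo + m \<le> length T" "a + m + lo \<le> length T" "m \<le> S"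
    and ext: "ext_le S s"
    and F: "\<And>j. j < m \<Longrightarrow> right_run T (lo + j) a m (mem s 1 j)"
    and R: "\<And>j. j < m \<Longrightarrow> left_run T (lo + j) a (mem s 3 j)"
    and Q: "\<And>s'. ctx T lo m (a + m) s' \<Longrightarrow> frame 9 s s' \<Longrightarrow>
      (\<And>j. j < m \<Longrightarrow> left_run T (lo + j) (a + m) (mem s' 3 j)) \<Longrightarrow> ext_le S s' \<Longrightarrow>
      reported s' = reported s \<Longrightarrow> pc s' \<le> pc s + 40 + 215 * m \<Longrightarrow> Q s'"
  shows "wp w T backward Q s"
proof -
  have w: "0 < w" using bounds by (cases w) auto
  note r = ctx[unfolded ctx_def]
  \<comment> \<open>\<open>d\<close> is the number of periods from \<open>lo\<close> on for which
    the last position of the block still has a partner in the string.\<close>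
  define d where "d = length T - lo + 1 - a - m"
  define cnt where "cnt = min m d"
  have d: "1 \<le> d" "d + a + m + lo = length T + 1" using bounds by (auto simp: d_def)
  have cnt: "1 \<le> cnt" "cnt \<le> m" "cnt \<le> d" using d bounds by (auto simp: cnt_def)
  let ?px = "a + m - 1" and ?py = "a + m - 1 + lo + cnt - 1"
  have small: "(Suc (length T - lo + 2 ^ w) - a) mod 2 ^ w = Suc (length T - lo) - a"
    "(Suc (length T - lo) - a + 2 ^ w - m) mod 2 ^ w = d"
    "(m + cnt) mod 2 ^ w = m + cnt"
    "(a + m - Suc 0 + lo) mod 2 ^ w = a + m - Suc 0 + lo"
    "(a + m - Suc 0 + lo + cnt) mod 2 ^ w = a + m - Suc 0 + lo + cnt"
    "(a + m - Suc 0 + lo + cnt + 2 ^ w - Suc 0) mod 2 ^ w = a + m - Suc 0 + lo + cnt - Suc 0"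
    "(a + m + 2 ^ w - Suc 0) mod 2 ^ w = a + m - Suc 0"
    using bounds d cnt sub_mod[of 1 "a + m" w] sub_mod[of a "Suc (length T - lo)" w]
      sub_mod[of m "Suc (length T - lo) - a" w] sub_mod[of 1 "a + m - 1 + lo + cnt" w]
    by (simp_all add: d_def)
  have small': "(a + m) mod 2 ^ w = a + m" using bounds by simp
  show ?thesis
    unfolding backward_def
    apply (simp add: wp_simps r small(7) small')
  proof (rule wp_zloop, goal_cases)
    case (9 s1)
    have r1: "reg s1 rN = length T" "reg s1 rZero = 0" "reg s1 rOne = 1" "reg s1 rLo = lo"
      "reg s1 rM = m" "reg s1 rA = a" "reg s1 rE = length T - lo + 1" "reg s1 rPx = ?px"
      "reg s1 rPy = ?px" "reg s1 rCnt = m" and f: "frame 9 s s1"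
      using 9(1) r by (simp_all add: frame_def)
    have mem1: "mem s1 1 = mem s 1" "mem s1 3 = mem s 3" and rep1: "reported s1 = reported s"
      and pc1: "pc s1 \<le> pc s + 12 + 100 * m"
      using 9(2) 9(3)[of 1] 9(3)[of 3] 9(7) r by simp_all
    have table: "is_ext (chr w T Sub ?px) (chr w T Sub ?px) m m k (mem s1 0 k)" if "1 \<le> k" "k < m" for k
      using 9(5)[of k] that r by simp
    have ext1: "ext_le S s1"
      by (rule ext_le_max[OF _ 9(6)]) (use bounds ext r in simp_all)
    \<comment> \<open>Stated for any suitable state \<open>t\<close>, since both branches that
      compute \<open>min m d\<close> continue with it.\<close>
    have main: "wp w T (zloop Sub 2) (wp w T (update;; Op Add rA rA rM) Q) t"
      if t: "frame 11 s1 t" "reg t rPy = ?py" "reg t rCnt = cnt" "reg t rLim = m + cnt" "reg t rI = 0"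
        "mem t = mem s1" "ext_le S t" "reported t = reported s" "pc t \<le> pc s1 + 12" for t
    proof -
      have rt: "reg t rN = length T" "reg t rZero = 0" "reg t rOne = 1" "reg t rLo = lo"
        "reg t rM = m" "reg t rA = a" "reg t rE = length T - lo + 1" "reg t rPx = ?px"
        using t(1) by (simp_all add: frame_def r1)
      show ?thesis
      proof (rule wp_zloop, goal_cases)
        case (9 s2)
        have r2: "reg s2 rN = length T" "reg s2 rZero = 0" "reg s2 rOne = 1" "reg s2 rLo = lo"
          "reg s2 rM = m" "reg s2 rA = a" "reg s2 rE = length T - lo + 1" "reg s2 rCnt = cnt"
          using 9(1) by (simp_all add: frame_def rt t)
        have mem2: "mem s2 1 = mem s 1" "mem s2 3 = mem s 3"
          using 9(3)[of 1] 9(3)[of 3] t mem1 by simp_all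
        have ext2: "ext_le S s2"
          by (rule ext_le_max[OF t(7) 9(6)]) (use bounds rt in simp_all)
        have G: "is_ext (chr w T Sub ?px) (chr w T Sub ?py) m (m + cnt) i (mem s2 2 i)" if "i < cnt" for i
          using 9(5)[of i] that t rt by simp
        show ?case
          unfolding wp_Seq
        proof (rule wp_update[where S = S], goal_cases)
          case (8 s3)
          have r3: "reg s3 rN = length T" "reg s3 rZero = 0" "reg s3 rOne = 1" "reg s3 rLo = lo"
            "reg s3 rM = m" "reg s3 rA = a" "reg s3 rE = length T - lo + 1"
            using 8(1) by (simp_all add: frame_def r2)
          have "Q (set_reg rA (a + m) s3)"
          proof (rule Q)
            show "ctx T lo m (a + m) (set_reg rA (a + m) s3)" by (simp add: ctx_def r3)
            show "frame 9 s (set_reg rA (a + m) s3)"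
              using f t(1) 9(1) 8(1) by (simp add: frame_def)
            show "ext_le S (set_reg rA (a + m) s3)" using 8 by simp
            show "reported (set_reg rA (a + m) s3) = reported s" using 8 9 t by simp
            show "pc (set_reg rA (a + m) s3) \<le> pc s + 40 + 215 * m"
              using 8(5) 9(7) t(9) pc1 by (simp add: r2 rt)
            show "left_run T (lo + j) (a + m) (mem (set_reg rA (a + m) s3) 3 j)" if j: "j < m" for j
            proof -
              have upd: "mem s3 3 j = (if mem s 1 j < m then if j < cnt then mem s2 2 (cnt - 1 - j) else 0
                  else mem s 3 j + m)"
                using 8(2)[of j] j mem2 r2 by simp
              \<comment> \<open>Either the whole block is good, or it has a bad position and its
                last position has a partner, or its last position has none; in the third case
                \<open>cnt = d\<close> and the run is empty.\<close>
              consider "\<not> mem s 1 j < m" | "mem s 1 j < m" "j < cnt" | "mem s 1 j < m" "\<not> j < cnt" by blast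
              then show ?thesis
              proof cases
                case 1
                then have "mem s 1 j = m" using F[OF j] by (simp add: right_run_def)
                then show ?thesis
                  using left_run_extend[OF R[OF j], of m] F[OF j] upd by simp
              next
                case 2
                then show ?thesis
                  using left_run_is_ext[OF G[of "cnt - 1 - j"], where f = "mem s 1 j"] F[OF j] upd bounds cnt d
                  by simp
              next
                case 3
                then have "cnt = d" using j by (simp add: cnt_def min_def split: if_splits)
                with 3 show ?thesis using upd d by (simp add: left_run_beyond)
              qed
            qed
          qed
          with small' show ?case by (simp add: wp_simps r3)
        next
          case (7 j)
          note 7[unfolded r2 mem2]
          then have "mem s 1 j = m" "mem s 3 j \<le> a"
            using F[of j] R[of j] by (simp_all add: right_run_def left_run_def)
          with bounds show ?case unfolding r2 mem2 by simp
        qed (use bounds ext2 r2 cnt in auto)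
      qed (use w bounds table rt t cnt in auto)
    qed
    show ?case
    proof (cases "m < d")
      case True
      then have c: "cnt = m" by (simp add: cnt_def)
      show ?thesis
        using True ext1 rep1
        apply (simp add: wp_simps r1 small[unfolded c])
        apply (rule main)
        apply (simp_all add: frame_def c)
        done
    next
      case False
      then have c: "cnt = d" by (simp add: cnt_def)
      show ?thesis
        using False ext1 rep1
        apply (simp add: wp_simps r1 small[unfolded c])
        apply (rule main)
        apply (simp_all add: frame_def c)
        done
    qed
  qed (use w bounds r in auto)
qed

text \<open>If the next block would begin beyond \<open>length T - lo\<close>, no run has to be
  carried over and the position jumps straight to \<open>rE\<close>.\<close>

definition block :: com where
  "block = (forward;; report;; Op Sub rI rE rA;; Cond rM rI backward (Move rA rE))"

lemma wp_block:
  assumes ctx: "ctx T lo m a s"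
    and bounds: "length T < 2 ^ w" "0 < m" "m \<le> lo" "lo + m \<le> length T" "a + lo \<le> length T" "m \<le> S"
    and ext: "ext_le S s"
    and R: "\<And>j. j < m \<Longrightarrow> left_run T (lo + j) a (mem s 3 j)"
    and rep: "distinct (reported s)" "set (reported s) = found T lo m a"
    and Q: "\<And>s'. frame 9 s s' \<Longrightarrow> ext_le S s' \<Longrightarrow> distinct (reported s') \<Longrightarrow>
      set (reported s') = found T lo m (a + m) \<Longrightarrow>
      reg s' rA = (if a + m + lo \<le> length T then a + m else length T - lo + 1) \<Longrightarrow>
      (\<And>j. j < m \<Longrightarrow> a + m + lo \<le> length T \<Longrightarrow> left_run T (lo + j) (a + m) (mem s' 3 j)) \<Longrightarrow>
      pc s' + 5 * length (reported s) \<le> pc s + 500 * m + 5 * length (reported s') \<Longrightarrow> Q s'"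
  shows "wp w T block Q s"
  unfolding block_def wp_Seq
proof (rule wp_forward[OF ctx bounds ext], goal_cases)
  case (1 s1)
  have ctx1: "ctx T lo m a s1" using ctx 1(1) by (simp add: ctx_frame)
  note r1 = ctx1[unfolded ctx_def]
  show ?case
  proof (rule wp_report[where S = S], goal_cases)
    case (14 s2)
    have f: "frame 10 s1 s2" using 14(1) by (rule frame_mono) simp
    have ctx2: "ctx T lo m a s2" using ctx1 f by (simp add: ctx_frame)
    note r2 = ctx2[unfolded ctx_def]
    have sub: "(Suc (length T - lo + 2 ^ w) - a) mod 2 ^ w = Suc (length T - lo) - a"
      "(Suc (length T + 2 ^ w) - (lo + a)) mod 2 ^ w = Suc (length T) - (lo + a)"
      using bounds sub_mod[of a "Suc (length T - lo)" w] sub_mod[of "lo + a" "Suc (length T)" w]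
      by simp_all
    have mem2: "mem s2 = mem s1" using 14(2) .
    have c: "m < Suc (length T - lo) - a \<longleftrightarrow> a + m + lo \<le> length T" using bounds by auto
    have pc2: "pc s2 + 5 * length (reported s) \<le> pc s + 19 + 220 * m + 5 * length (reported s2)"
      using 14(6) 1(5,6) by (simp add: r1)
    have rep2: "distinct (reported s2)" "set (reported s2) = found T lo m (a + m)"
      using 14(4,5) r1 by simp_all
    have f2: "frame 9 s s2" using 1(1) f by (simp add: frame_def)
    show ?case
    proof (cases "a + m + lo \<le> length T")
      case True
      let ?t = "tick 1 (set_reg rI (Suc (length T - lo) - a) s2)"
      have "wp w T backward Q ?t"
      proof (rule wp_backward[where S = S and T = T and lo = lo and m = m and a = a], goal_cases)
        case (11 s3)
        show ?case
        proof (rule Q)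
          show "frame 9 s s3" using f2 11(2) by (simp add: frame_def)
          show "reg s3 rA = (if a + m + lo \<le> length T then a + m else length T - lo + 1)"
            using 11(1) True by (simp add: ctx_def)
          show "pc s3 + 5 * length (reported s) \<le> pc s + 500 * m + 5 * length (reported s3)"
            using 11(5,6) pc2 bounds by simp
        qed (use 11 rep2 in auto)
      next
        case (9 j)
        then show ?case using 1(3)[of j] by (simp add: mem2)
      next
        case (10 j)
        then show ?case using R[of j] 1(2) by (simp add: mem2)
      qed (use ctx2 14(3) True bounds in \<open>simp_all add: ctx_def\<close>)
      then show ?thesis using True c by (simp add: wp_simps r2 sub)
    next
      case False
      have "Q (tick 1 (set_reg rA (Suc (length T - lo)) (tick 1 (set_reg rI (Suc (length T - lo) - a) s2))))"
        using f2 rep2 14(3) False pc2 bounds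
        by (intro Q) (simp_all add: frame_def)
      then show ?thesis using False c by (simp add: wp_simps r2 sub)
    qed
  qed (use 1 r1 bounds R rep in auto)
qed

section \<open>One batch of periods\<close>

definition batch :: com where
  "batch = (Move rM rS;; Cond rLo rM (Move rM rLo) Skip;; Op Sub rE rN rLo;; Op Add rE rE rOne;;
     clear;; Move rA rZero;; While Skip rA rE block;; Op Add rLo rLo rM)"

definition found_below :: "nat list \<Rightarrow> nat \<Rightarrow> (nat \<times> nat) set" where
  "found_below T lo = {(i, p) \<in> tandem_repeats T. p < lo}"

lemma found_0: "found T lo m 0 = found_below T lo"
  by (auto simp: found_def found_below_def ended_def)

text \<open>For a square of period \<open>p \<ge> lo\<close>, position \<open>length T - p\<close>
  is bad, lies at or after the start of the square and lies below \<open>a\<close>. Hence all runs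
  have ended.\<close>

lemma found_all:
  assumes "length T < a + lo"
  shows "found T lo m a = found_below T (lo + m)"
proof -
  have "ended T p a i" if "(i, p) \<in> tandem_repeats T" "\<not> p < lo" for i p
  proof -
    have sq: "0 < p" "\<forall>t<p. period_at T p (i + t)" using that by (simp_all add: tandem_repeats_iff)
    have "p - 1 < p" using sq(1) by simp
    with sq(2) have "period_at T p (i + (p - 1))" by blast
    then have "i + p + p \<le> length T" using sq(1) by (auto simp: period_at_def)
    with that assms show ?thesis
      unfolding ended_def by (intro exI[of _ "length T - p"]) (auto simp: period_at_def)
  qed
  then show ?thesis by (auto simp: found_def found_below_def)
qed

lemma wp_batch:
  fixes s T
  defines "n \<equiv> length T" and "lo \<equiv> reg s rLo" and "S \<equiv> reg s rS"
  defines "m \<equiv> min lo S"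
  assumes regs: "reg s rN = n" "reg s rZero = 0" "reg s rOne = 1"
    and bounds: "n < 2 ^ w" "0 < lo" "0 < S" "2 * lo \<le> n"
    and ext: "ext_le S s"
    and rep: "distinct (reported s)" "set (reported s) = found_below T lo"
    and Q: "\<And>s'. frame 5 s s' \<Longrightarrow> reg s' rHi = reg s rHi \<Longrightarrow> reg s' rLo = lo + m \<Longrightarrow> ext_le S s' \<Longrightarrow>
      distinct (reported s') \<Longrightarrow> set (reported s') = found_below T (lo + m) \<Longrightarrow>
      pc s' + 5 * length (reported s) \<le> pc s + 1100 * n + 5 * length (reported s') \<Longrightarrow> Q s'"
  shows "wp w T batch Q s"
proof -
  have m: "0 < m" "m \<le> lo" "m \<le> S" "lo + m \<le> n" using bounds by (auto simp: m_def)
  \<comment> \<open>The 1 ensures that position \<open>n - lo\<close> is processed; it is the first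
    one without a partner at distance \<open>lo\<close>.\<close>
  let ?N = "n - lo + 1"
  define loop_start where "loop_start t \<longleftrightarrow> ctx T lo m 0 t \<and> frame 5 s t \<and> reg t rHi = reg s rHi \<and>
    ext_le S t \<and> reported t = reported s \<and> (\<forall>j<m. mem t 3 j = 0) \<and> pc t \<le> pc s + 20 + 4 * m" for t
  have loop: "wp w T (While Skip rA rE block) (wp w T (Op Add rLo rLo rM) Q) t" if t: "loop_start t" for t
  proof -
    \<comment> \<open>502 steps per position cover the 500 of a block and the two jumps of the loop.
      The last block may overshoot the end but costs as much as a full one, whence the extra
      \<open>m\<close>.\<close>
    define I where "I s' \<longleftrightarrow> (\<exists>a. ctx T lo m a s' \<and> a \<le> ?N \<and> frame 5 s s' \<and> reg s' rHi = reg s rHi \<and>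
      ext_le S s' \<and> distinct (reported s') \<and> set (reported s') = found T lo m a \<and>
      (a < ?N \<longrightarrow> (\<forall>j<m. left_run T (lo + j) a (mem s' 3 j))) \<and>
      pc s' + 5 * length (reported s) \<le> pc t + 502 * (if a < ?N then a else ?N + m)
         + 5 * length (reported s'))" for s'
    show ?thesis
    proof (rule wp_while[where I = I and \<mu> = "\<lambda>s'. ?N - reg s' rA"], goal_cases)
      case 1
      show ?case
        unfolding I_def
        using t rep bounds by (intro exI[of _ 0]) (simp add: loop_start_def left_run_0 found_0)
    next
      case (2 s')
      then obtain a where a: "ctx T lo m a s'" "a \<le> ?N" "frame 5 s s'" "reg s' rHi = reg s rHi"
        "ext_le S s'" "distinct (reported s')" "set (reported s') = found T lo m a"
        "a < ?N \<longrightarrow> (\<forall>j<m. left_run T (lo + j) a (mem s' 3 j))"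
        "pc s' + 5 * length (reported s) \<le> pc t + 502 * (if a < ?N then a else ?N + m)
         + 5 * length (reported s')"
        unfolding I_def by blast
      note r = a(1)[unfolded ctx_def]
      show ?case
      proof (cases "a < ?N")
        case True
        have "wp w T block (\<lambda>s2. I (tick 1 s2) \<and> ?N - reg (tick 1 s2) rA < ?N - reg s' rA) (tick 1 s')"
        proof (rule wp_block[where S = S and a = a and lo = lo and m = m], goal_cases)
          case (12 s2)
          let ?b = "reg s2 rA"
          have ctx2: "ctx T lo m ?b s2" using 12(1) r by (simp add: frame_def ctx_def)
          have b: "?b \<le> ?N" "a < ?b" "?b < ?N \<longleftrightarrow> a + m + lo \<le> n" "?b < ?N \<longrightarrow> ?b = a + m"
            using 12(5) True m by (auto simp: n_def split: if_splits)
          have found: "set (reported s2) = found T lo m ?b"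
          proof (cases "?b < ?N")
            case True
            with b 12(4) show ?thesis by simp
          next
            case False
            with b have "length T < a + m + lo" "length T < ?b + lo" by (auto simp: n_def)
            with 12(4) show ?thesis by (simp add: found_all)
          qed
          have pcs: "pc s2 + 1 + 5 * length (reported s) \<le>
              pc t + 502 * (if ?b < ?N then ?b else ?N + m) + 5 * length (reported s2)"
            using 12(7) a(9) True b m by (auto split: if_splits)
          have "I (tick 1 s2)"
            unfolding I_def
          proof (intro exI[of _ ?b] conjI)
            show "frame 5 s (tick 1 s2)" using 12(1) a(3) by (simp add: frame_def)
            show "reg (tick 1 s2) rHi = reg s rHi" using 12(1) a(4) by (simp add: frame_def)
            show "?b < ?N \<longrightarrow> (\<forall>j<m. left_run T (lo + j) ?b (mem (tick 1 s2) 3 j))"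
            proof (intro impI allI)
              fix j assume "?b < ?N" "j < m"
              with b 12(6)[of j] show "left_run T (lo + j) ?b (mem (tick 1 s2) 3 j)"
                by (simp add: n_def)
            qed
            show "ctx T lo m ?b (tick 1 s2)" using ctx2 by (simp add: ctx_def)
          qed (use b(1) found pcs 12(2,3) in simp_all)
          with r True b show ?case by simp
        qed (use a True bounds m in \<open>auto simp: n_def ctx_def\<close>)
        with True r show ?thesis by (simp add: wp_simps n_def)
      next
        case False
        then have "a = ?N" using a(2) by simp
        have pct: "pc t \<le> pc s + 20 + 4 * m" using t by (simp add: loop_start_def)
        have "Q (set_reg rLo (lo + m) (tick 2 s'))"
        proof (rule Q)
          show "set (reported (set_reg rLo (lo + m) (tick 2 s'))) = found_below T (lo + m)"
            using a(7) \<open>a = ?N\<close> by (simp add: found_all n_def)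
          show "pc (set_reg rLo (lo + m) (tick 2 s')) + 5 * length (reported s) \<le>
              pc s + 1100 * n + 5 * length (reported (set_reg rLo (lo + m) (tick 2 s')))"
            using a(9) \<open>a = ?N\<close> m bounds pct by simp
        qed (use a in \<open>simp_all add: frame_def\<close>)
        with False r bounds m show ?thesis by (simp add: wp_simps n_def)
      qed
    qed
  qed
  have sub: "(length T + 2 ^ w - lo) mod 2 ^ w = length T - lo"
    "Suc (length T - lo) mod 2 ^ w = Suc (length T - lo)"
    using bounds m sub_mod[of lo "length T" w] by (simp_all add: n_def)
  have clear: "wp w T clear (wp w T (Move rA rZero;; While Skip rA rE block;; Op Add rLo rLo rM) Q) t"
    if t: "frame 5 s t" "reg t rLo = lo" "reg t rHi = reg s rHi" "reg t rM = m" "reg t rE = Suc (length T - lo)"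
       "ext_le S t" "reported t = reported s" "pc t \<le> pc s + 10" for t
  proof (rule wp_clear[where S = S], goal_cases)
    case (6 s1)
    have "loop_start (set_reg rA 0 s1)"
      using 6 t regs by (simp add: loop_start_def ctx_def frame_def n_def)
    moreover have "reg s1 rZero = 0" using 6 t regs by (simp add: frame_def)
    ultimately show ?case using loop by (simp add: wp_simps)
  qed (use t regs m bounds in \<open>simp_all add: frame_def\<close>)
  have r: "reg s rN = length T" "reg s rZero = 0" "reg s rOne = 1" "reg s rLo = lo" "reg s rS = S"
    using regs by (simp_all add: n_def lo_def S_def)
  show ?thesis
  proof (cases "lo < S")
    case True
    then have "m = lo" by (simp add: m_def)
    with True show ?thesis
      apply (simp add: batch_def wp_simps r sub)
      apply (rule clear)
             apply (simp_all add: frame_def r ext)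
      done
  next
    case False
    then have "m = S" by (simp add: m_def)
    with False show ?thesis
      apply (simp add: batch_def wp_simps r sub)
      apply (rule clear)
             apply (simp_all add: frame_def r ext)
      done
  qed
qed

section \<open>The outer loop over all batches\<close>

definition main :: com where
  "main = (Const rOne 1;; Op Div rS rN rTau;; Op Shr rHi rN rOne;; Op Add rHi rHi rOne;; Move rLo rOne;;
     While Skip rLo rHi batch)"

lemma tandem_repeats_period: "(i, p) \<in> tandem_repeats T \<Longrightarrow> 0 < p \<and> 2 * p \<le> length T"
  by (auto simp: tandem_repeats_def)

text \<open>\<open>b1\<close> counts the batches that double \<open>lo\<close> and \<open>b2\<close>
  those that add \<open>S\<close> to it, so their sum is the number of batches.\<close>

lemma big_main:
  assumes valid: "valid_input w T \<tau>"
  defines "S \<equiv> length T div \<tau>"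
  obtains s b1 b2 where "big w T main (start T \<tau>) s" "distinct (reported s)"
    "set (reported s) = tandem_repeats T" "ext_le S s" "2 ^ b1 \<le> length T" "b2 * S \<le> length T"
    "pc s \<le> 10 + 1102 * length T * (b1 + b2) + 5 * length (reported s)"
proof -
  let ?n = "length T"
  have n: "1 \<le> \<tau>" "\<tau> \<le> ?n" "?n < 2 ^ w" using valid by (simp_all add: valid_input_def)
  then have w: "0 < w" by (cases w) auto
  have S: "0 < S" using n by (simp add: S_def div_greater_zero_iff)
  define I where "I s \<longleftrightarrow> (\<exists>b1 b2. reg s rN = ?n \<and> reg s rZero = 0 \<and> reg s rOne = 1 \<and> reg s rS = S \<and>
    reg s rHi = ?n div 2 + 1 \<and> ext_le S s \<and> distinct (reported s) \<and> 0 < reg s rLo \<and> reg s rLo \<le> ?n \<and>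
    set (reported s) = found_below T (reg s rLo) \<and> 2 ^ b1 \<le> reg s rLo \<and> b2 * S \<le> reg s rLo \<and>
    pc s \<le> 8 + 1102 * ?n * (b1 + b2) + 5 * length (reported s))" for s
  define final where "final s \<longleftrightarrow> (\<exists>b1 b2. distinct (reported s) \<and>
    set (reported s) = tandem_repeats T \<and> ext_le S s \<and> 2 ^ b1 \<le> ?n \<and> b2 * S \<le> ?n \<and>
    pc s \<le> 10 + 1102 * ?n * (b1 + b2) + 5 * length (reported s))" for s
  have loop: "wp w T (While Skip rLo rHi batch) final s" if "I s" for s
  proof (rule wp_while[where I = I and \<mu> = "\<lambda>s. reg s rHi - reg s rLo", OF that], goal_cases)
    case (1 t)
    then obtain b1 b2 where t: "reg t rN = ?n" "reg t rZero = 0" "reg t rOne = 1" "reg t rS = S"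
      "reg t rHi = ?n div 2 + 1" "ext_le S t" "distinct (reported t)" "0 < reg t rLo" "reg t rLo \<le> ?n"
      "set (reported t) = found_below T (reg t rLo)" "2 ^ b1 \<le> reg t rLo" "b2 * S \<le> reg t rLo"
      "pc t \<le> 8 + 1102 * ?n * (b1 + b2) + 5 * length (reported t)"
      unfolding I_def by blast
    let ?lo = "reg t rLo"
    show ?case
    proof (cases "?lo < ?n div 2 + 1")
      case True
      have "wp w T batch (\<lambda>s2. I (tick 1 s2) \<and> reg (tick 1 s2) rHi - reg (tick 1 s2) rLo < reg t rHi - ?lo)
        (tick 1 t)"
      proof (rule wp_batch, goal_cases)
        case (11 s2)
        have f: "reg s2 rN = ?n" "reg s2 rZero = 0" "reg s2 rOne = 1" "reg s2 rS = S"
          using 11(1) t by (simp_all add: frame_def)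
        have lo: "reg s2 rLo = ?lo + min ?lo S" "reg s2 rLo \<le> ?n" "?lo < reg s2 rLo"
          using 11(3) True t S by auto
        have pcs: "pc s2 + 1 \<le> 8 + 1102 * ?n * (b1 + b2 + 1) + 5 * length (reported s2)"
          using 11(7) t(13) n by (simp add: algebra_simps)
        have "I (tick 1 s2)"
        \<comment> \<open>For \<open>?lo \<le> S\<close> the batch doubles \<open>lo\<close> and
          \<open>b1\<close> grows; otherwise \<open>lo\<close> gains \<open>S\<close> and
          \<open>b2\<close> grows.\<close>
        proof (cases "?lo \<le> S")
          case True
          then have "2 ^ Suc b1 \<le> reg s2 rLo" "b2 * S \<le> reg s2 rLo"
            using lo t(11,12) by simp_all
          moreover have "Suc b1 + b2 = b1 + b2 + 1" by simp
          ultimately show ?thesis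
            unfolding I_def using f lo pcs 11 t
            by (intro exI[of _ "Suc b1"] exI[of _ b2]) simp
        next
          case False
          then have "2 ^ b1 \<le> reg s2 rLo" "Suc b2 * S \<le> reg s2 rLo"
            using lo t(11,12) by simp_all
          moreover have "b1 + Suc b2 = b1 + b2 + 1" by simp
          ultimately show ?thesis
            unfolding I_def using f lo pcs 11 t
            by (intro exI[of _ b1] exI[of _ "Suc b2"]) simp
        qed
        with lo(3) 11(2) True t(5) show ?case by (simp add: diff_less_mono2)
      qed (use t True n S in auto)
      with True t(5) show ?thesis by (simp add: wp_simps)
    next
      case False
      \<comment> \<open>A square has period at most half the length of the string, so no longer
        periods need a batch.\<close>
      have "found_below T ?lo = tandem_repeats T"
        using False tandem_repeats_period[of _ _ T] by (fastforce simp: found_below_def)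
      moreover have "2 ^ b1 \<le> ?n" "b2 * S \<le> ?n" using t(9,11,12) by linarith+
      ultimately have "final (tick 2 t)"
        unfolding final_def using t
        by (intro exI[of _ b1] exI[of _ b2]) simp
      with False t(5) show ?thesis by (simp add: wp_simps)
    qed
  qed
  have hi: "Suc (?n div 2) mod 2 ^ w = Suc (?n div 2)" using n by auto
  have st: "pc (start T \<tau>) = 0" "reg (start T \<tau>) = (\<lambda>_. 0)(0 := ?n, 1 := \<tau>)"
    "extent (start T \<tau>) = (\<lambda>_. 0)" "reported (start T \<tau>) = []"
    by (simp_all add: start_def)
  have empty: "found_below T (Suc 0) = {}"
    using tandem_repeats_period[of _ _ T] by (fastforce simp: found_below_def)
  have "wp w T main final (start T \<tau>)"
    unfolding main_def
    apply (simp add: wp_simps w hi st)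
    apply (rule loop)
    unfolding I_def
    apply (intro exI[of _ "0 :: nat"])
    using n S apply (simp add: S_def ext_le_def st empty)
    done
  then show thesis unfolding wp_def final_def using that by blast
qed

section \<open>Comparison of the running time and space with the two bounds\<close>

theorem theorem4:
  shows "(\<exists>P. \<exists>C::real. \<forall>w T \<tau>. valid_input w T \<tau> \<longrightarrow>
            solves_tandem_repeats w T \<tau> P \<and>
            in_space w T \<tau> P (C * (real (length T) / sqrt (real \<tau>))) \<and>
            in_time w T \<tau> P
              (C * (real (length T) ^ 2 / sqrt (real \<tau>)
                    + real (length T) * real \<tau> * log 2 (real (length T))
                    + real (occ T))))
       \<and> (\<forall>c::real. 0 < c \<longrightarrow>
            (\<exists>P. \<exists>C::real. \<forall>w T \<tau>. valid_input w T \<tau> \<longrightarrow>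
              solves_tandem_repeats w T \<tau> P \<and>
              in_space w T \<tau> P (C * (real (length T) / real \<tau>)) \<and>
              in_time_with_prob w T \<tau> P
                (C * (real (length T) * real \<tau> * (log 2 (real (length T))) ^ 2
                      + real (occ T)))
                (1 - 1 / real (length T) powr c)))"
proof -
  define P where "P = code main 0"
  txt \<open>The summand 1 cannot be dropped for \<open>length T = 1\<close>, where the logarithm vanishes.\<close>
  have time: "\<exists>b. b \<le> 6000 * (1 + real (length T) * real \<tau> * log 2 (real (length T)) + real (occ T)) \<and>
      (2 \<le> length T \<longrightarrow> b \<le> 6000 * (real (length T) * real \<tau> * log 2 (real (length T)) + real (occ T))) \<and>
      in_time w T \<tau> P b \<and> (\<forall>q\<le>1. in_time_with_prob w T \<tau> P b q) \<and>
      solves_tandem_repeats w T \<tau> P \<and> in_space w T \<tau> P (4 * (real (length T) / real \<tau>))"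
    if valid: "valid_input w T \<tau>" for w T \<tau>
  proof -
    define S where "S = length T div \<tau>"
    obtain s b1 b2 where s: "big w T main (start T \<tau>) s" "distinct (reported s)"
      "set (reported s) = tandem_repeats T" "ext_le S s" "2 ^ b1 \<le> length T" "b2 * S \<le> length T"
      "pc s \<le> 10 + 1102 * length T * (b1 + b2) + 5 * length (reported s)"
      unfolding S_def by (rule big_main[OF valid])
    have n: "1 \<le> \<tau>" "\<tau> \<le> length T" using valid by (simp_all add: valid_input_def)
    have S: "0 < S" using n by (simp add: S_def div_greater_zero_iff)
    note prog = big_program[OF s(1-3), folded P_def]
    have "length (reported s) = occ T" using s(2,3) by (metis occ_def distinct_card)
    with s(7) have "real (pc s) \<le> real (10 + 1102 * length T * (b1 + b2) + 5 * occ T)"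
      by (simp only: of_nat_le_iff)
    then have pcs: "real (pc s) \<le> 10 + 1102 * real (length T) * (real b1 + real b2) + 5 * real (occ T)"
      by simp
    let ?L = "log 2 (real (length T))"
    have b1: "real b1 \<le> ?L" by (rule le_log2_of_power[OF s(5)])
    \<comment> \<open>Since \<open>S \<ge> 1\<close>, rounding in the division loses at most a
      factor 2, which yields fewer than \<open>2 * \<tau>\<close> batches that add
      \<open>S\<close>.\<close>
    have "length T < (S + 1) * \<tau>"
      using n dividend_less_div_times[of \<tau> "length T"] by (simp add: S_def)
    also have "\<dots> \<le> 2 * S * \<tau>" using S by simp
    finally have "b2 * S < 2 * S * \<tau>" using s(6) by (rule le_less_trans[rotated])
    also have "2 * S * \<tau> = (2 * \<tau>) * S" by simp
    finally have "b2 < 2 * \<tau>" by (simp only: mult_less_cancel2)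
    then have b2: "real b2 \<le> 2 * real \<tau>" by linarith
    have space: "in_space w T \<tau> P (4 * (real (length T) / real \<tau>))"
    proof (rule prog(2)[of "{..<4}" S])
      have "real S \<le> real (length T) / real \<tau>" unfolding S_def by (rule of_nat_div_le_of_nat)
      then show "real (card {..<4::nat} * S) \<le> 4 * (real (length T) / real \<tau>)" by simp
    qed (use s(4) in \<open>auto simp: ext_le_def\<close>)
    have big: "real (pc s) \<le> 6000 * (real (length T) * real \<tau> * ?L + real (occ T))" if n2: "2 \<le> length T"
    proof -
      have L: "1 \<le> ?L" using le_log2_of_power[of 1 "length T"] n2 by simp
      have t: "1 \<le> real \<tau>" using n by simp
      \<comment> \<open>As both factors are at least 1, their product dominates each of them, so the
        sum of \<open>log n\<close> and \<open>\<tau>\<close> is absorbed by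
        \<open>\<tau> * log n\<close>.\<close>
      have "?L \<le> real \<tau> * ?L" "real \<tau> \<le> real \<tau> * ?L"
        using mult_right_mono[of 1 "real \<tau>" ?L] mult_left_mono[of 1 ?L "real \<tau>"] L t by simp_all
      with b1 b2 have "real b1 + real b2 \<le> 3 * (real \<tau> * ?L)" by linarith
      then have "real (length T) * (real b1 + real b2) \<le> real (length T) * (3 * (real \<tau> * ?L))"
        by (rule mult_left_mono) simp
      moreover have "1 * (1 * 1) \<le> real (length T) * (real \<tau> * ?L)"
        using n2 t L by (intro mult_mono) auto
      ultimately show ?thesis using pcs by (simp add: algebra_simps)
    qed
    have "real (pc s) \<le> 6000 * (1 + real (length T) * real \<tau> * ?L + real (occ T))"
    proof (cases "2 \<le> length T")
      case True
      with big show ?thesis by fastforce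
    next
      case False
      then have "length T = 1" "\<tau> = 1" using n by auto
      with pcs b1 b2 show ?thesis by simp
    qed
    with big prog(1,3,4) space show ?thesis by (intro exI[of _ "real (pc s)"]) auto
  qed
  have space_mono: "in_space w T \<tau> P b \<Longrightarrow> b \<le> b' \<Longrightarrow> in_space w T \<tau> P b'" for w T \<tau> b b'
    unfolding in_space_def by (meson order_trans)
  have time_mono: "in_time w T \<tau> P b \<Longrightarrow> b \<le> b' \<Longrightarrow> in_time w T \<tau> P b'" for w T \<tau> b b'
    unfolding in_time_def by (meson order_trans)
  have prob_mono: "in_time_with_prob w T \<tau> P b q \<Longrightarrow> b \<le> b' \<Longrightarrow> in_time_with_prob w T \<tau> P b' q" for w T \<tau> b b' q
    unfolding in_time_with_prob_def by (meson order_trans)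
  show ?thesis
  \<comment> \<open>The same program and constant serve both parts and every \<open>c\<close>. Being
    deterministic, the program meets the time bound of the second part with certainty for
    \<open>2 \<le> length T\<close>.\<close>
  proof (intro conjI allI impI exI[of _ P] exI[of _ "6000 :: real"], goal_cases)
    case (1 w T \<tau>)
    with time show ?case by blast
  next
    case (2 w T \<tau>)
    then have t: "1 \<le> \<tau>" by (simp add: valid_input_def)
    \<comment> \<open>The space \<open>n / \<tau>\<close> is within \<open>n / sqrt \<tau>\<close>
      because \<open>\<tau> \<ge> 1\<close>.\<close>
    then have "sqrt (real \<tau>) \<le> real \<tau>" by (simp add: real_le_lsqrt power2_eq_square)
    then have "real (length T) / real \<tau> \<le> real (length T) / sqrt (real \<tau>)"
      using t by (intro divide_left_mono) auto
    moreover have "0 \<le> real (length T) / real \<tau>" by simp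
    ultimately have "4 * (real (length T) / real \<tau>) \<le> 6000 * (real (length T) / sqrt (real \<tau>))" by linarith
    with time[OF 2] space_mono show ?case by blast
  next
    case (3 w T \<tau>)
    then have t: "1 \<le> real \<tau>" "real \<tau> \<le> real (length T)" by (simp_all add: valid_input_def)
    \<comment> \<open>The additive 1 of the time bound is absorbed by the first summand, which is at
      least 1.\<close>
    have "sqrt (real \<tau>) \<le> real \<tau>" using t by (simp add: real_le_lsqrt power2_eq_square)
    also have "\<dots> \<le> real (length T) ^ 2"
      using t mult_left_mono[of 1 "real (length T)" "real (length T)"] by (simp add: power2_eq_square)
    finally have "1 \<le> real (length T) ^ 2 / sqrt (real \<tau>)" using t by (simp add: le_divide_eq)
    with time[OF 3] time_mono show ?case by fastforce
  next
    case (4 c w T \<tau>)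
    with time show ?case by blast
  next
    case (5 c w T \<tau>)
    have "4 * (real (length T) / real \<tau>) \<le> 6000 * (real (length T) / real \<tau>)"
      by (rule mult_right_mono) simp_all
    with time[OF 5(2)] space_mono show ?case by blast
  next
    case (6 c w T \<tau>)
    then have t: "1 \<le> \<tau>" "\<tau> \<le> length T" by (simp_all add: valid_input_def)
    show ?case
    proof (cases "2 \<le> length T")
      case True
      then have L: "1 \<le> log 2 (real (length T))" using le_log2_of_power[of 1 "length T"] by simp
      \<comment> \<open>For strings of length at least 2 the logarithm is at least 1, hence at most
        its square.\<close>
      then have "log 2 (real (length T)) \<le> log 2 (real (length T)) ^ 2"
        using mult_left_mono[OF L, of "log 2 (real (length T))"] by (simp add: power2_eq_square)
      then have "real (length T) * real \<tau> * log 2 (real (length T))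
          \<le> real (length T) * real \<tau> * log 2 (real (length T)) ^ 2"
        by (rule mult_left_mono) simp
      moreover have "1 - 1 / real (length T) powr c \<le> 1" by simp
      ultimately show ?thesis using time[OF 6(2)] True prob_mono by fastforce
    next
      case False
      then have "length T = 1" using t by simp
      then show ?thesis \<comment> \<open>the required probability is 0\<close>
        unfolding in_time_with_prob_def by (intro exI[of _ 0]) simp
    qed
  qed
qed

end
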